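(* Let $n\ge 2$, let $q_1,\dots,q_n>0$, and let $E=\{x\in\mathbb{R}^n : \sum_{i=1}^n q_i^2x_i^2\le 1\}$. Then $$\frac{V_{n-1}(\partial E)}{V_n(E)} = n\,⨍_{\mathbb{S}^{n-1}}\sqrt{\sum_{i=1}^n u_i^2q_i^2}\;d\sigma(u),$$ where $⨍_{\mathbb{S}^{n-1}}$ denotes the average over the unit sphere.
   Context: $V_n(E)$ is the $n$-dimensional volume of $E$ and $V_{n-1}(\partial E)$ is the surface area ($(n-1)$-dimensional volume) of its boundary. $\mathbb{S}^{n-1}$ is the unit sphere in $\mathbb{R}^n$ and $\sigma$ is the standard area measure on it. For a function $f$ on the sphere, $⨍_{\mathbb{S}^{n-1}} f\,d\sigma = \frac{1}{\sigma(\mathbb{S}^{n-1})}\int_{\mathbb{S}^{n-1}} f\,d\sigma$. *)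

theory Defs
  imports "HOL-Analysis.Analysis"
begin

section \<open>Hausdorff measure\<close>

text \<open>The \<open>k\<close>-dimensional Hausdorff measure, normalised as usual by
  $\omega_k (\mathrm{diam}\,C / 2)^k$ with $\omega_k$ the volume of the unit ball of
  $\mathbb{R}^k$, so that it agrees with Lebesgue measure on $\mathbb{R}^k$.
  The empty set is treated separately because \<open>0 ^ 0 = 1\<close>. Covers are required to be
  bounded because \<^const>\<open>diameter\<close> is unspecified on unbounded sets.\<close>

definition hausdorff_weight :: "nat \<Rightarrow> 'a::metric_space set \<Rightarrow> real" where
  "hausdorff_weight k C =
     (if C = {} then 0 else unit_ball_vol (real k) * (diameter C / 2) ^ k)"

definition hausdorff_covers :: "real \<Rightarrow> 'a::metric_space set \<Rightarrow> (nat \<Rightarrow> 'a set) set" where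
  "hausdorff_covers \<delta> A =
     {C. (\<forall>i. bounded (C i) \<and> diameter (C i) \<le> \<delta>) \<and> A \<subseteq> (\<Union>i. C i)}"

definition hausdorff_premeasure :: "nat \<Rightarrow> real \<Rightarrow> 'a::metric_space set \<Rightarrow> ennreal" where
  "hausdorff_premeasure k \<delta> A =
     (INF C\<in>hausdorff_covers \<delta> A. \<Sum>i. ennreal (hausdorff_weight k (C i)))"

definition hausdorff_outer_measure :: "nat \<Rightarrow> 'a::metric_space set \<Rightarrow> ennreal" where
  "hausdorff_outer_measure k A = (SUP \<delta>\<in>{0<..}. hausdorff_premeasure k \<delta> A)"

definition hausdorff_measure :: "nat \<Rightarrow> 'a::metric_space measure" where
  "hausdorff_measure k = measure_of UNIV (sets borel) (hausdorff_outer_measure k)"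

lemma space_hausdorff_measure [simp]: "space (hausdorff_measure k) = UNIV"
  by (simp add: hausdorff_measure_def space_measure_of_conv)

lemma sets_hausdorff_measure [simp, measurable_cong]:
  "sets (hausdorff_measure k :: 'a::metric_space measure) = sets borel"
  using sets.sigma_sets_eq[of "borel :: 'a measure"]
  by (simp add: hausdorff_measure_def sets_measure_of_conv)

section \<open>Area measure and averages on the unit sphere\<close>

definition sphere_area :: "(real ^ 'n) measure" where
  "sphere_area = restrict_space (hausdorff_measure (CARD('n) - 1)) (sphere 0 1)"

definition sphere_average :: "(real ^ 'n \<Rightarrow> real) \<Rightarrow> real" where
  "sphere_average f =
     (\<integral>u. f u \<partial>sphere_area) / measure (sphere_area :: (real ^ 'n) measure) (sphere 0 1)"

section \<open>The Hausdorff outer measure restricts to a measure on the Borel sets\<close>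

text \<open>\<^const>\<open>measure_of\<close> yields the zero measure when its argument is not countably additive,
  so we check that this does not happen here.\<close>

lemma hausdorff_weight_empty [simp]: "hausdorff_weight k {} = 0"
  by (simp add: hausdorff_weight_def)

lemma hausdorff_premeasure_mono:
  "A \<subseteq> B \<Longrightarrow> hausdorff_premeasure k \<delta> A \<le> hausdorff_premeasure k \<delta> B"
  unfolding hausdorff_premeasure_def
  by (rule INF_superset_mono) (auto simp: hausdorff_covers_def)

lemma hausdorff_premeasure_antimono:
  "\<delta> \<le> \<delta>' \<Longrightarrow> hausdorff_premeasure k \<delta>' A \<le> hausdorff_premeasure k \<delta> A"
  unfolding hausdorff_premeasure_def
  by (rule INF_superset_mono) (auto simp: hausdorff_covers_def intro: order_trans)

lemma hausdorff_premeasure_UN: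
  "hausdorff_premeasure k \<delta> (\<Union>n. A n) \<le> (\<Sum>n. hausdorff_premeasure k \<delta> (A n))"
proof (rule ennreal_le_epsilon)
  fix e :: real
  assume fin: "(\<Sum>n. hausdorff_premeasure k \<delta> (A n)) < top" and e: "0 < e"
  let ?P = "hausdorff_premeasure k \<delta>"
  have fin_n: "?P (A n) \<noteq> top" for n
    using ennreal_suminf_lessD[OF fin, of n] by simp
  have "\<exists>C\<in>hausdorff_covers \<delta> (A n).
      (\<Sum>i. ennreal (hausdorff_weight k (C i))) \<le> ?P (A n) + e * (1 / 2) ^ Suc n" for n
  proof -
    have "?P (A n) < ?P (A n) + ennreal (e * (1 / 2) ^ Suc n)"
      using fin_n[of n] e by (simp add: less_top)
    then show ?thesis
      unfolding hausdorff_premeasure_def INF_less_iff by (auto intro: less_imp_le)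
  qed
  then obtain C where C: "\<And>n. C n \<in> hausdorff_covers \<delta> (A n)"
    and le: "\<And>n. (\<Sum>i. ennreal (hausdorff_weight k (C n i))) \<le> ?P (A n) + e * (1 / 2) ^ Suc n"
    by metis
  let ?D = "\<lambda>i. case_prod C (prod_decode i)"
  have "(\<Union>n. A n) \<subseteq> (\<Union>i. ?D i)"
  proof
    fix x assume "x \<in> (\<Union>n. A n)"
    then obtain n i where "x \<in> C n i" using C by (fastforce simp: hausdorff_covers_def)
    then have "x \<in> ?D (prod_encode (n, i))" by simp
    then show "x \<in> (\<Union>i. ?D i)" by (rule UN_I[OF UNIV_I])
  qed
  then have "?D \<in> hausdorff_covers \<delta> (\<Union>n. A n)"
    using C by (auto simp: hausdorff_covers_def split: prod.split)
  then have "?P (\<Union>n. A n) \<le> (\<Sum>i. ennreal (hausdorff_weight k (?D i)))"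
    unfolding hausdorff_premeasure_def by (rule INF_lower)
  also have "\<dots> = (\<Sum>n. \<Sum>i. ennreal (hausdorff_weight k (C n i)))"
    using suminf_ennreal_2dimen[of _ "\<lambda>(n, i). ennreal (hausdorff_weight k (C n i))"]
    by (simp add: case_prod_unfold)
  also have "\<dots> \<le> (\<Sum>n. ?P (A n) + e * (1 / 2) ^ Suc n)"
    by (intro suminf_le le) auto
  also have "\<dots> = (\<Sum>n. ?P (A n)) + (\<Sum>n. ennreal (e * (1 / 2) ^ Suc n))"
    by (intro suminf_add[symmetric]) auto
  also have "(\<Sum>n. ennreal (e * (1 / 2) ^ Suc n)) = ennreal e"
    using e sums_mult[OF power_half_series, of e] by (intro suminf_ennreal_eq) simp_all
  finally show "?P (\<Union>n. A n) \<le> (\<Sum>n. ?P (A n)) + ennreal e" .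
qed

lemma hausdorff_outer_measure_empty [simp]: "hausdorff_outer_measure k {} = 0"
proof -
  have "hausdorff_premeasure k \<delta> ({} :: 'a set) \<le> 0" if "0 < \<delta>" for \<delta>
    unfolding hausdorff_premeasure_def
    by (rule INF_lower2[of "\<lambda>_. {}"]) (use that in \<open>auto simp: hausdorff_covers_def\<close>)
  then show ?thesis
    by (auto simp: hausdorff_outer_measure_def intro!: antisym SUP_least)
qed

lemma hausdorff_outer_measure_mono:
  "A \<subseteq> B \<Longrightarrow> hausdorff_outer_measure k A \<le> hausdorff_outer_measure k B"
  unfolding hausdorff_outer_measure_def by (intro SUP_mono) (auto intro: hausdorff_premeasure_mono)

lemma hausdorff_outer_measure_UN:
  "hausdorff_outer_measure k (\<Union>n. A n) \<le> (\<Sum>n. hausdorff_outer_measure k (A n))"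
  unfolding hausdorff_outer_measure_def
proof (rule SUP_least)
  fix \<delta> :: real assume "\<delta> \<in> {0<..}"
  then show "hausdorff_premeasure k \<delta> (\<Union>n. A n)
      \<le> (\<Sum>n. SUP \<delta>\<in>{0<..}. hausdorff_premeasure k \<delta> (A n))"
    by (intro order_trans[OF hausdorff_premeasure_UN] suminf_le SUP_upper) auto
qed

lemma outer_measure_space_hausdorff:
  "outer_measure_space (Pow UNIV) (hausdorff_outer_measure k)"
  by (auto simp: outer_measure_space_def positive_def increasing_def countably_subadditive_def
      intro: hausdorff_outer_measure_mono hausdorff_outer_measure_UN)

lemma hausdorff_outer_measure_Un:
  "hausdorff_outer_measure k (A \<union> B) \<le> hausdorff_outer_measure k A + hausdorff_outer_measure k B"
proof -
  let ?f = "\<lambda>i::nat. if i = 0 then A else if i = 1 then B else {}"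
  have "A \<union> B \<subseteq> (\<Union>i. ?f i)"
    using UN_upper[of 0 UNIV ?f] UN_upper[of 1 UNIV ?f] by simp
  then have "hausdorff_outer_measure k (A \<union> B) \<le> (\<Sum>i. hausdorff_outer_measure k (?f i))"
    by (rule order_trans[OF hausdorff_outer_measure_mono hausdorff_outer_measure_UN])
  also have "\<dots> = (\<Sum>i\<in>{0, 1}. hausdorff_outer_measure k (?f i))"
    by (rule suminf_finite) auto
  finally show ?thesis by simp
qed

lemma hausdorff_outer_measure_separated:
  assumes d: "0 < d" and sep: "\<And>x y. x \<in> A \<Longrightarrow> y \<in> B \<Longrightarrow> d \<le> dist x y"
  shows "hausdorff_outer_measure k A + hausdorff_outer_measure k B
    \<le> hausdorff_outer_measure k (A \<union> B)"
proof -
  let ?P = "hausdorff_premeasure k"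
  have le: "?P \<alpha> A + ?P \<beta> B \<le> hausdorff_outer_measure k (A \<union> B)" if "0 < \<alpha>" "0 < \<beta>" for \<alpha> \<beta>
  proof -
    define \<delta> where "\<delta> = min (min \<alpha> \<beta>) (d / 2)"
    have \<delta>: "0 < \<delta>" "\<delta> \<le> \<alpha>" "\<delta> \<le> \<beta>" "\<delta> < d" using that d by (auto simp: \<delta>_def)
    have "?P \<alpha> A + ?P \<beta> B \<le> ?P \<delta> A + ?P \<delta> B"
      using \<delta> by (intro add_mono hausdorff_premeasure_antimono)
    also have "\<dots> \<le> ?P \<delta> (A \<union> B)"
      unfolding hausdorff_premeasure_def[of k \<delta> "A \<union> B"]
    proof (rule INF_greatest)
      fix C assume C: "C \<in> hausdorff_covers \<delta> (A \<union> B)"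
      define CA where "CA i = (if C i \<inter> A = {} then {} else C i)" for i
      define CB where "CB i = (if C i \<inter> B = {} then {} else C i)" for i
      have disj: "C i \<inter> A = {} \<or> C i \<inter> B = {}" for i
      proof (rule ccontr)
        assume "\<not> ?thesis"
        then obtain x y where "x \<in> C i" "x \<in> A" "y \<in> C i" "y \<in> B" by blast
        moreover have "bounded (C i)" "diameter (C i) \<le> \<delta>" using C by (auto simp: hausdorff_covers_def)
        ultimately show False
          using sep[of x y] diameter_bounded_bound[of "C i" x y] \<delta> by linarith
      qed
      have "CA \<in> hausdorff_covers \<delta> A" "CB \<in> hausdorff_covers \<delta> B"
        using C \<delta> by (fastforce simp: hausdorff_covers_def CA_def CB_def)+
      then have "?P \<delta> A + ?P \<delta> B \<le> (\<Sum>i. ennreal (hausdorff_weight k (CA i)))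
          + (\<Sum>i. ennreal (hausdorff_weight k (CB i)))"
        unfolding hausdorff_premeasure_def by (intro add_mono INF_lower)
      also have "\<dots> = (\<Sum>i. ennreal (hausdorff_weight k (CA i)) + ennreal (hausdorff_weight k (CB i)))"
        by (intro suminf_add) auto
      also have "\<dots> \<le> (\<Sum>i. ennreal (hausdorff_weight k (C i)))"
        using disj by (intro suminf_le) (auto simp: CA_def CB_def)
      finally show "?P \<delta> A + ?P \<delta> B \<le> (\<Sum>i. ennreal (hausdorff_weight k (C i)))" .
    qed
    also have "\<dots> \<le> hausdorff_outer_measure k (A \<union> B)"
      unfolding hausdorff_outer_measure_def using \<delta> by (intro SUP_upper) auto
    finally show ?thesis .
  qed
  have "?P \<alpha> A + hausdorff_outer_measure k B \<le> hausdorff_outer_measure k (A \<union> B)"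
    if "0 < \<alpha>" for \<alpha>
    unfolding hausdorff_outer_measure_def[of k B]
    by (subst ennreal_SUP_add_right) (auto intro!: SUP_least le that)
  then show ?thesis
    unfolding hausdorff_outer_measure_def[of k A]
    by (subst ennreal_SUP_add_left[symmetric]) (auto intro!: SUP_least)
qed

lemma hausdorff_outer_measure_layers:
  assumes "\<And>i j::nat. i < j \<Longrightarrow> \<exists>d>0. \<forall>x\<in>D i. \<forall>y\<in>D j. d \<le> dist x y"
  shows "(\<Sum>i<m. hausdorff_outer_measure k (D i)) \<le> hausdorff_outer_measure k (\<Union>i<m. D i)"
proof (induction m)
  case (Suc m)
  have "\<exists>d>0. \<forall>x\<in>(\<Union>i<j. D i). \<forall>y\<in>D m. d \<le> dist x y" if "j \<le> m" for j
    using that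
  proof (induction j)
    case 0
    show ?case by (intro exI[of _ 1]) simp
  next
    case (Suc j)
    then obtain d where d: "0 < d" "\<forall>x\<in>(\<Union>i<j. D i). \<forall>y\<in>D m. d \<le> dist x y" by auto
    obtain d' where d': "0 < d'" "\<forall>x\<in>D j. \<forall>y\<in>D m. d' \<le> dist x y"
      using assms[of j m] Suc.prems by auto
    show ?case
      using d d' by (intro exI[of _ "min d d'"]) (auto simp: lessThan_Suc min_le_iff_disj)
  qed
  then obtain d where d: "0 < d" "\<forall>x\<in>(\<Union>i<m. D i). \<forall>y\<in>D m. d \<le> dist x y" by blast
  have "(\<Sum>i<Suc m. hausdorff_outer_measure k (D i))
      \<le> hausdorff_outer_measure k (\<Union>i<m. D i) + hausdorff_outer_measure k (D m)"
    using Suc.IH by (simp add: add_right_mono)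
  also have "\<dots> \<le> hausdorff_outer_measure k ((\<Union>i<m. D i) \<union> D m)"
    using d by (intro hausdorff_outer_measure_separated[of d]) auto
  finally show ?case by (simp add: lessThan_Suc Un_commute)
qed simp

lemma closed_in_lambda_system_hausdorff:
  fixes F :: "'a::metric_space set"
  assumes "closed F"
  shows "F \<in> lambda_system UNIV (Pow UNIV) (hausdorff_outer_measure k)"
proof -
  let ?H = "hausdorff_outer_measure k :: 'a set \<Rightarrow> ennreal"
  have main: "?H (X \<inter> F) + ?H (X - F) \<le> ?H X" if ne: "F \<noteq> {}" for X
  proof (cases "?H X = top")
    case False
    define B where "B n = {x \<in> X. 1 / real (Suc n) \<le> infdist x F}" for n
    define D where "D n = B (Suc n) - B n" for n
    have sep: "\<exists>d>0. \<forall>x\<in>D i. \<forall>y\<in>D j. d \<le> dist x y" if "Suc i < j" for i j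
    proof (intro exI[of _ "1 / real (i + 2) - 1 / real (j + 1)"] conjI ballI)
      show "0 < 1 / real (i + 2) - 1 / real (j + 1)" 
        using that by (auto intro!: divide_strict_left_mono)
      fix x y assume "x \<in> D i" "y \<in> D j"
      then have "1 / real (i + 2) \<le> infdist x F" "infdist y F < 1 / real (j + 1)"
        by (auto simp: D_def B_def)
      moreover have "infdist x F \<le> infdist y F + dist x y" by (rule infdist_triangle)
      ultimately show "1 / real (i + 2) - 1 / real (j + 1) \<le> dist x y" by linarith
    qed
    have half: "(\<Sum>i. ?H (D (2 * i + r))) \<le> ?H X" for r
    proof (rule suminf_le_const[OF summableI])
      fix m
      have "(\<Sum>i<m. ?H (D (2 * i + r))) \<le> ?H (\<Union>i<m. D (2 * i + r))"
        by (rule hausdorff_outer_measure_layers) (auto intro: sep)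
      also have "\<dots> \<le> ?H X"
        by (rule hausdorff_outer_measure_mono) (auto simp: D_def B_def)
      finally show "(\<Sum>i<m. ?H (D (2 * i + r))) \<le> ?H X" .
    qed
    have "(\<Sum>i. ?H (D i)) \<le> ?H X + ?H X"
    proof (rule suminf_le_const[OF summableI])
      fix m
      have "(\<Sum>i<m. ?H (D i)) \<le> (\<Sum>i<2 * m. ?H (D i))"
        by (intro sum_mono2) auto
      also have "\<dots> = (\<Sum>i<m. ?H (D (2 * i + 0))) + (\<Sum>i<m. ?H (D (2 * i + 1)))"
        by (induction m) (simp_all add: ac_simps)
      also have "\<dots> \<le> ?H X + ?H X"
        by (intro add_mono order_trans[OF sum_le_suminf half]) auto
      finally show "(\<Sum>i<m. ?H (D i)) \<le> ?H X + ?H X" .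
    qed
    then have fin: "(\<Sum>i. ?H (D i)) \<noteq> top"
      using False by (auto simp: top_unique)
    have le: "?H (X \<inter> F) + ?H (X - F) \<le> ?H X + (\<Sum>i. ?H (D (i + n)))" for n
    proof -
      have "X - F \<subseteq> B n \<union> (\<Union>i. D (i + n))"
      proof
        fix x assume x: "x \<in> X - F"
        then have "infdist x F > 0"
          using in_closed_iff_infdist_zero[OF assms ne, of x] infdist_nonneg[of x F] by auto
        then obtain m where m: "1 / real (Suc m) < infdist x F"
          using nat_approx_posE by metis
        have "x \<in> B m" using m x by (simp add: B_def)
        show "x \<in> B n \<union> (\<Union>i. D (i + n))"
        proof (cases "x \<in> B n")
          case False
          define j where "j = (LEAST j. x \<in> B j)"
          have j: "x \<in> B j" and min: "\<And>l. l < j \<Longrightarrow> x \<notin> B l"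
            unfolding j_def using \<open>x \<in> B m\<close> by (auto intro: LeastI dest: not_less_Least)
          have "n < j"
          proof (rule ccontr)
            assume "\<not> n < j"
            then have "1 / real (Suc n) \<le> 1 / real (Suc j)" by (simp add: frac_le)
            with j False show False by (auto simp: B_def)
          qed
          then obtain i where "j = Suc (i + n)" using less_iff_Suc_add by (auto simp: add.commute)
          with j min[of "i + n"] show ?thesis by (auto simp: D_def)
        qed simp
      qed
      then have "?H (X - F) \<le> ?H (B n \<union> (\<Union>i. D (i + n)))"
        by (rule hausdorff_outer_measure_mono)
      also have "\<dots> \<le> ?H (B n) + ?H (\<Union>i. D (i + n))"
        by (rule hausdorff_outer_measure_Un)
      also have "\<dots> \<le> ?H (B n) + (\<Sum>i. ?H (D (i + n)))"
        by (intro add_left_mono hausdorff_outer_measure_UN)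
      finally have "?H (X - F) \<le> ?H (B n) + (\<Sum>i. ?H (D (i + n)))" .
      then have "?H (X \<inter> F) + ?H (X - F) \<le> (?H (X \<inter> F) + ?H (B n)) + (\<Sum>i. ?H (D (i + n)))"
        by (simp add: add.assoc add_left_mono)
      also have "?H (X \<inter> F) + ?H (B n) \<le> ?H (X \<inter> F \<union> B n)"
      proof (rule hausdorff_outer_measure_separated)
        show "0 < 1 / real (Suc n)" by simp
        fix x y assume "x \<in> X \<inter> F" "y \<in> B n"
        then show "1 / real (Suc n) \<le> dist x y"
          using infdist_le[of x F y] by (simp add: B_def dist_commute)
      qed
      also have "\<dots> \<le> ?H X" by (rule hausdorff_outer_measure_mono) (auto simp: B_def)
      finally show ?thesis by (simp add: add_right_mono)
    qed
    have summ: "summable (\<lambda>i. enn2real (?H (D i)))"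
      and eq: "\<And>i. ?H (D i) = ennreal (enn2real (?H (D i)))"
    proof -
      have f: "?H (D i) < top" for i using fin ennreal_suminf_lessD[of "\<lambda>i. ?H (D i)" top i]
        by (simp add: less_top)
      then show "\<And>i. ?H (D i) = ennreal (enn2real (?H (D i)))" by simp
      show "summable (\<lambda>i. enn2real (?H (D i)))"
        using fin f by (intro summable_suminf_not_top) auto
    qed
    have "(\<lambda>n. \<Sum>i. enn2real (?H (D (i + n)))) \<longlonglongrightarrow> 0"
      by (rule suminf_exist_split2[OF summ])
    moreover have "(\<Sum>i. ?H (D (i + n))) = ennreal (\<Sum>i. enn2real (?H (D (i + n))))" for n
      by (subst eq, rule suminf_ennreal2)
         (auto simp: summable_iff_shift[of "\<lambda>i. enn2real (?H (D i))"] summ)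
    ultimately have "(\<lambda>n. \<Sum>i. ?H (D (i + n))) \<longlonglongrightarrow> 0"
      using tendsto_ennrealI by fastforce
    then have "(\<lambda>n. ?H X + (\<Sum>i. ?H (D (i + n)))) \<longlonglongrightarrow> ?H X + 0"
      by (intro tendsto_add tendsto_const)
    with le show ?thesis by (auto intro: LIMSEQ_le_const)
  qed simp
  have "?H (X \<inter> F) + ?H (X - F) = ?H X" for X
  proof (rule antisym)
    show "?H (X \<inter> F) + ?H (X - F) \<le> ?H X"
      using main by (cases "F = {}") auto
    have "?H X \<le> ?H (X \<inter> F \<union> (X - F))" by (rule hausdorff_outer_measure_mono) blast
    also have "\<dots> \<le> ?H (X \<inter> F) + ?H (X - F)" by (rule hausdorff_outer_measure_Un)
    finally show "?H X \<le> ?H (X \<inter> F) + ?H (X - F)" .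
  qed
  then show ?thesis
    by (auto simp: lambda_system_def Int_commute Diff_eq)
qed

lemma emeasure_hausdorff_measure:
  fixes A :: "'a::metric_space set"
  assumes "A \<in> sets borel"
  shows "emeasure (hausdorff_measure k) A = hausdorff_outer_measure k A"
proof -
  let ?H = "hausdorff_outer_measure k :: 'a set \<Rightarrow> ennreal"
  let ?L = "lambda_system UNIV (Pow UNIV) ?H"
  interpret sigma_algebra UNIV "Pow (UNIV :: 'a set)" by (rule sigma_algebra_Pow)
  have L: "measure_space UNIV ?L ?H"
    by (rule caratheodory_lemma[OF outer_measure_space_hausdorff])
  then have sa: "sigma_algebra UNIV ?L" by (simp add: measure_space_def)
  have "sets (borel :: 'a measure) = sigma_sets UNIV (Collect closed)"
    by (simp add: borel_eq_closed)
  also have "\<dots> \<subseteq> ?L"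
    using closed_in_lambda_system_hausdorff
    by (intro sigma_algebra.sigma_sets_subset[OF sa]) blast
  finally have sub: "sets (borel :: 'a measure) \<subseteq> ?L" .
  show ?thesis
  proof (rule emeasure_measure_of[OF hausdorff_measure_def])
    show "positive (sets (hausdorff_measure k)) ?H" by (simp add: positive_def)
    have "countably_additive ?L ?H" using L by (simp add: measure_space_def)
    show "countably_additive (sets (hausdorff_measure k)) ?H"
    proof (rule countably_additiveI)
      fix A :: "nat \<Rightarrow> 'a set"
      assume "range A \<subseteq> sets (hausdorff_measure k)" "disjoint_family A"
        "(\<Union>i. A i) \<in> sets (hausdorff_measure k)"
      with sub have "range A \<subseteq> ?L" "disjoint_family A" "(\<Union>i. A i) \<in> ?L"
        unfolding sets_hausdorff_measure by blast+
      then show "(\<Sum>i. ?H (A i)) = ?H (\<Union>i. A i)"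
        using \<open>countably_additive ?L ?H\<close> unfolding countably_additive_def by blast
    qed
  qed (use assms in auto)
qed

end

theory Submission
  imports Defs
begin

text \<open>
  Write \<open>Q x\<close> for the vector with entries \<open>q i * x i\<close>, so that the ellipsoid is \<open>norm (Q x) \<le> 1\<close>,
  and let \<open>n\<close> be the dimension and \<open>k = n - 1\<close>.

  If \<open>p\<close> is a boundary point of the ellipsoid, then the vector \<open>g = Q (Q p)\<close> is normal to the
  boundary there and satisfies \<open>g \<bullet> p = 1\<close>, so the tangent plane at \<open>p\<close> has distance \<open>1 / norm g\<close>
  from the origin. A small piece \<open>A\<close> of the boundary near \<open>p\<close> is almost a flat piece of that plane,
  and the cone over \<open>A\<close> with apex \<open>0\<close> is almost a pyramid of this height. Hence
  \<open>H\<^sup>k A \<approx> n * norm g * vol (cone A)\<close>. Summing up small pieces gives the exact identity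
  \[ H^k(A) = \int_{\mathrm{cone}(A)} n \, \frac{|Q (Q x)|}{|Q x|} \, dx \]
  for all Borel subsets \<open>A\<close> of the boundary (\<open>hausdorff_measure_surf\<close>). The integrand is the value
  of \<open>n * norm g\<close> at the boundary point above \<open>x\<close>.

  The identity is used twice. For the ellipsoid itself, the substitution \<open>y = Q x\<close> turns the total
  area into \<open>n / det Q\<close> times the integral of \<open>norm (Q y) / norm y\<close> over the unit ball, while the
  volume of the ellipsoid is that of the unit ball divided by \<open>det Q\<close>. For the unit ball, where \<open>Q\<close> is
  the identity, it says that the area measure of the sphere is \<open>n\<close> times the image of Lebesgue
  measure on the ball under radial projection (\<open>nn_integral_sphere_area\<close>), so that the average of
  \<open>norm (Q u)\<close> over the sphere is the average of \<open>norm (Q y) / norm y\<close> over the ball.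

  The comparison of a piece \<open>A\<close> with its cone (\<open>surface_piece_vs_cone\<close>) rests on two facts. Radial
  projection from the tangent plane to the boundary is Lipschitz in both directions with constants
  tending to 1 near \<open>p\<close> (\<open>radial_almost_isometry\<close>), because it changes points only to second order.
  And \<open>H\<^sup>k\<close> is Lebesgue measure on \<open>k\<close>-dimensional Euclidean space
  (\<open>hausdorff_outer_measure_eq_lborel\<close>), which in one direction is the isodiametric inequality
  and in the other the Vitali covering theorem.
\<close>

section \<open>Hausdorff measure and Lipschitz maps\<close>

lemma hausdorff_outer_measure_Lipschitz_image:
  fixes f :: "'a::metric_space \<Rightarrow> 'b::metric_space"
  assumes c: "0 < c" and lip: "\<And>x y. x \<in> A \<Longrightarrow> y \<in> A \<Longrightarrow> dist (f x) (f y) \<le> c * dist x y"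
  shows "hausdorff_outer_measure k (f ` A) \<le> ennreal (c ^ k) * hausdorff_outer_measure k A"
proof -
  have main: "hausdorff_premeasure k \<delta> (f ` A) \<le> ennreal (c ^ k) * hausdorff_premeasure k (\<delta> / c) A" for \<delta>
  proof -
    have cancel: "ennreal (c ^ k) * (ennreal (1 / c ^ k) * X) = X" "ennreal (1 / c ^ k) * (ennreal (c ^ k) * X) = X" for X
      using c by (simp_all add: mult.assoc[symmetric] ennreal_mult'[symmetric])
    have "ennreal (1 / c ^ k) * hausdorff_premeasure k \<delta> (f ` A) \<le> hausdorff_premeasure k (\<delta> / c) A"
      unfolding hausdorff_premeasure_def[of k "\<delta> / c"]
    proof (rule INF_greatest)
      fix C assume C: "C \<in> hausdorff_covers (\<delta> / c) A"
      define D where "D i = f ` (C i \<inter> A)" for i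
      have bC: "bounded (C i)" "diameter (C i) \<le> \<delta> / c" for i
        using C by (auto simp: hausdorff_covers_def)
      have dd: "dist u v \<le> c * diameter (C i)" if uv: "u \<in> D i" "v \<in> D i" for u v i
      proof -
        obtain x y where xy: "x \<in> C i" "x \<in> A" "y \<in> C i" "y \<in> A" "u = f x" "v = f y"
          using uv unfolding D_def by blast
        have "dist u v \<le> c * dist x y" using xy lip by simp
        also have "\<dots> \<le> c * diameter (C i)"
          using c diameter_bounded_bound[OF bC(1), of x i y] xy by simp
        finally show ?thesis .
      qed
      have bD: "bounded (D i)" for i
        unfolding bounded_two_points using dd by blast
      have dD: "diameter (D i) \<le> c * diameter (C i)" for i
      proof (cases "D i = {}")
        case True
        then show ?thesis using c diameter_ge_0[OF bC(1)] by simp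
      next
        case False
        then show ?thesis unfolding diameter_def[of "D i"]
          using dd[of _ i] by (auto intro!: cSUP_least)
      qed
      have "c * diameter (C i) \<le> \<delta>" for i
        using bC(2)[of i] c by (simp add: field_simps)
      then have "D \<in> hausdorff_covers \<delta> (f ` A)"
        using C bD order_trans[OF dD] by (fastforce simp: hausdorff_covers_def D_def)
      then have "hausdorff_premeasure k \<delta> (f ` A) \<le> (\<Sum>i. ennreal (hausdorff_weight k (D i)))"
        unfolding hausdorff_premeasure_def by (rule INF_lower)
      also have "\<dots> \<le> (\<Sum>i. ennreal (c ^ k) * ennreal (hausdorff_weight k (C i)))"
      proof (intro suminf_le)
        fix i
        have "hausdorff_weight k (D i) \<le> c ^ k * hausdorff_weight k (C i)"
        proof (cases "D i = {}")
          case True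
          then show ?thesis
            using c diameter_ge_0[OF bC(1)] by (auto simp: hausdorff_weight_def)
        next
          case False
          then have "C i \<noteq> {}" by (auto simp: D_def)
          moreover have "(diameter (D i) / 2) ^ k \<le> c ^ k * (diameter (C i) / 2) ^ k"
            unfolding power_mult_distrib[symmetric]
            using dD[of i] diameter_ge_0[OF bD] by (intro power_mono) auto
          ultimately show ?thesis using False
            by (simp add: hausdorff_weight_def mult.left_commute)
        qed
        then show "ennreal (hausdorff_weight k (D i)) \<le> ennreal (c ^ k) * ennreal (hausdorff_weight k (C i))"
          using c by (simp add: ennreal_mult'[symmetric] ennreal_leI)
      qed auto
      also have "\<dots> = ennreal (c ^ k) * (\<Sum>i. ennreal (hausdorff_weight k (C i)))"
        by simp
      finally have "hausdorff_premeasure k \<delta> (f ` A)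
        \<le> ennreal (c ^ k) * (\<Sum>i. ennreal (hausdorff_weight k (C i)))" .
      from mult_left_mono[OF this, of "ennreal (1 / c ^ k)"]
      show "ennreal (1 / c ^ k) * hausdorff_premeasure k \<delta> (f ` A)
        \<le> (\<Sum>i. ennreal (hausdorff_weight k (C i)))"
        by (simp add: cancel)
    qed
    from mult_left_mono[OF this, of "ennreal (c ^ k)"] show ?thesis
      by (simp add: cancel)
  qed
  show ?thesis
    unfolding hausdorff_outer_measure_def[of k "f ` A"]
  proof (rule SUP_least)
    fix \<delta> :: real assume "\<delta> \<in> {0<..}"
    then have "hausdorff_premeasure k (\<delta> / c) A \<le> hausdorff_outer_measure k A"
      using c unfolding hausdorff_outer_measure_def by (intro SUP_upper) auto
    then show "hausdorff_premeasure k \<delta> (f ` A) \<le> ennreal (c ^ k) * hausdorff_outer_measure k A"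
      by (rule order_trans[OF main mult_left_mono]) simp
  qed
qed

section \<open>The isodiametric inequality\<close>

text \<open>
  Steiner symmetrisation of \<open>C\<close> in direction \<open>i\<close>: every line parallel to the \<open>i\<close>-th axis meets the
  new set in the open interval that is centred at 0 and as long as the section of \<open>C\<close>. Points are
  functions on a finite index set \<open>I\<close>, so that the coordinates can be split off one at a time by
  Fubini.
\<close>
definition steiner :: "'i set \<Rightarrow> 'i \<Rightarrow> ('i \<Rightarrow> real) set \<Rightarrow> ('i \<Rightarrow> real) set" where
  "steiner I i C = {f \<in> I \<rightarrow>\<^sub>E UNIV. ennreal (2 * \<bar>f i\<bar>) < emeasure lborel {t. f(i := t) \<in> C}}"

lemma
  assumes C: "C \<in> sets (Pi\<^sub>M I (\<lambda>_. lborel :: real measure))" and i: "i \<in> I"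
  shows sets_section: "f \<in> I \<rightarrow>\<^sub>E UNIV \<Longrightarrow> {t. f(i := t) \<in> C} \<in> sets borel"
    and sets_steiner: "steiner I i C \<in> sets (Pi\<^sub>M I (\<lambda>_. lborel))"
proof -
  let ?P = "Pi\<^sub>M I (\<lambda>_. lborel :: real measure)"
  have upd: "(\<lambda>(f, t). f(i := t)) \<in> ?P \<Otimes>\<^sub>M lborel \<rightarrow>\<^sub>M ?P"
    unfolding case_prod_beta
    by (rule measurable_fun_upd[where J = I]) (use i in auto)
  have ind: "(\<lambda>(f, t). indicator C (f(i := t)) :: ennreal) \<in> borel_measurable (?P \<Otimes>\<^sub>M lborel)"
  proof -
    have "(\<lambda>x. indicator C ((\<lambda>(f, t). f(i := t)) x) :: ennreal) \<in> borel_measurable (?P \<Otimes>\<^sub>M lborel)"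
      by (rule measurable_compose[OF upd borel_measurable_indicator[OF C]])
    then show ?thesis by (simp add: case_prod_beta)
  qed
  have sec: "{t. f(i := t) \<in> C} \<in> sets borel" if f: "f \<in> I \<rightarrow>\<^sub>E UNIV" for f
  proof -
    have "(\<lambda>t. f(i := t)) \<in> (lborel :: real measure) \<rightarrow>\<^sub>M ?P"
      by (rule measurable_fun_upd[where J = I]) (use i f in \<open>auto simp: space_PiM\<close>)
    from measurable_sets[OF this C] show ?thesis by (simp add: vimage_def)
  qed
  then show "f \<in> I \<rightarrow>\<^sub>E UNIV \<Longrightarrow> {t. f(i := t) \<in> C} \<in> sets borel" .
  have len: "emeasure lborel {t. f(i := t) \<in> C} = (\<integral>\<^sup>+ t. indicator C (f(i := t)) \<partial>lborel)"
    if "f \<in> I \<rightarrow>\<^sub>E UNIV" for f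
  proof -
    have "{t. f(i := t) \<in> C} \<in> sets lborel" using sec[OF that] by simp
    from nn_integral_indicator[OF this] show ?thesis by (simp add: indicator_def)
  qed
  have m1: "(\<lambda>f. \<integral>\<^sup>+ t. indicator C (f(i := t)) \<partial>lborel) \<in> borel_measurable ?P"
    using ind by (rule lborel.borel_measurable_nn_integral)
  have m2: "(\<lambda>f. ennreal (2 * \<bar>f i\<bar>)) \<in> borel_measurable ?P"
    using measurable_component_singleton[OF i, of "\<lambda>_. lborel :: real measure"] by simp
  have "{f \<in> space ?P. ennreal (2 * \<bar>f i\<bar>) < (\<integral>\<^sup>+ t. indicator C (f(i := t)) \<partial>lborel)} \<in> sets ?P"
    using m1 m2 by measurable
  also have "{f \<in> space ?P. ennreal (2 * \<bar>f i\<bar>) < (\<integral>\<^sup>+ t. indicator C (f(i := t)) \<partial>lborel)} = steiner I i C"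
    using len by (auto simp: steiner_def space_PiM)
  finally show "steiner I i C \<in> sets ?P" .
qed

lemma emeasure_symmetric_interval:
  "emeasure lborel {t::real. ennreal (2 * \<bar>t\<bar>) < m} = m"
proof (cases m)
  case (real r)
  then have "{t::real. ennreal (2 * \<bar>t\<bar>) < m} = {- (r / 2) <..< r / 2}"
    by (auto simp: ennreal_less_iff)
  then show ?thesis using real by simp
next
  case top
  then show ?thesis by simp
qed

lemma emeasure_steiner:
  assumes I: "finite I" and C: "C \<in> sets (Pi\<^sub>M I (\<lambda>_. lborel :: real measure))" and i: "i \<in> I"
  shows "emeasure (Pi\<^sub>M I (\<lambda>_. lborel)) (steiner I i C) = emeasure (Pi\<^sub>M I (\<lambda>_. lborel)) C"
proof -
  interpret product_sigma_finite "\<lambda>_. lborel :: real measure" ..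
  define J where "J = I - {i}"
  have J: "finite J" "i \<notin> J" "I = insert i J" using I i by (auto simp: J_def)
  let ?P = "Pi\<^sub>M I (\<lambda>_. lborel :: real measure)"
  have fubini: "emeasure ?P D = (\<integral>\<^sup>+ f. emeasure lborel {t. f(i := t) \<in> D} \<partial>Pi\<^sub>M J (\<lambda>_. lborel))"
    if D: "D \<in> sets ?P" for D
  proof -
    have "emeasure ?P D = (\<integral>\<^sup>+ f. indicator D f \<partial>?P)" using D by simp
    also have "\<dots> = (\<integral>\<^sup>+ f. \<integral>\<^sup>+ t. indicator D (f(i := t)) \<partial>lborel \<partial>Pi\<^sub>M J (\<lambda>_. lborel))"
      using D unfolding J(3) by (intro product_nn_integral_insert J(1,2)) simp
    also have "\<dots> = (\<integral>\<^sup>+ f. emeasure lborel {t. f(i := t) \<in> D} \<partial>Pi\<^sub>M J (\<lambda>_. lborel))"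
    proof (rule nn_integral_cong)
      fix f assume "f \<in> space (Pi\<^sub>M J (\<lambda>_. lborel :: real measure))"
      then have f: "f(i := 0) \<in> I \<rightarrow>\<^sub>E UNIV"
        by (auto simp: space_PiM J(3) PiE_iff extensional_def)
      have "{t. f(i := t) \<in> D} \<in> sets lborel"
        using sets_section[OF D i f] by simp
      then have "(\<integral>\<^sup>+ t. indicator {t. f(i := t) \<in> D} t \<partial>lborel) = emeasure lborel {t. f(i := t) \<in> D}"
        by (rule nn_integral_indicator)
      then show "(\<integral>\<^sup>+ t. indicator D (f(i := t)) \<partial>lborel) = emeasure lborel {t. f(i := t) \<in> D}"
        by (simp add: indicator_def)
    qed
    finally show ?thesis .
  qed
  show ?thesis
    unfolding fubini[OF C] fubini[OF sets_steiner[OF C i]]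
  proof (rule nn_integral_cong)
    fix f assume "f \<in> space (Pi\<^sub>M J (\<lambda>_. lborel :: real measure))"
    then have "f(i := t) \<in> I \<rightarrow>\<^sub>E UNIV" for t
      by (auto simp: space_PiM J(3) PiE_iff extensional_def)
    then have "{t. f(i := t) \<in> steiner I i C} =
        {t. ennreal (2 * \<bar>t\<bar>) < emeasure lborel {t. f(i := t) \<in> C}}"
      by (simp add: steiner_def)
    then show "emeasure lborel {t. f(i := t) \<in> steiner I i C} = emeasure lborel {t. f(i := t) \<in> C}"
      by (simp add: emeasure_symmetric_interval)
  qed
qed

lemma emeasure_le_length:
  fixes A :: "real set"
  assumes "A \<noteq> {}" "\<And>a. a \<in> A \<Longrightarrow> l \<le> a \<and> a \<le> u"
  shows "emeasure lborel A \<le> ennreal (u - l)"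
proof -
  have "emeasure lborel A \<le> emeasure lborel {l..u}"
    using assms(2) by (intro emeasure_mono) auto
  moreover have "l \<le> u" using assms by fastforce
  ultimately show ?thesis by simp
qed

text \<open>
  The reason why Steiner symmetrisation does not increase the diameter: if all differences between
  \<open>A\<close> and \<open>B\<close> are at most \<open>w\<close>, then \<open>Sup A - Inf B\<close> and \<open>Sup B - Inf A\<close> are at most \<open>w\<close>, hence the
  lengths of \<open>A\<close> and \<open>B\<close> add up to at most \<open>2 * w\<close>.
\<close>
lemma far_points_in_sections:
  fixes A B :: "real set"
  assumes A: "ennreal (2 * \<bar>x\<bar>) < emeasure lborel A" and B: "ennreal (2 * \<bar>y\<bar>) < emeasure lborel B"
  shows "\<exists>a\<in>A. \<exists>b\<in>B. \<bar>x - y\<bar> \<le> \<bar>a - b\<bar>"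
proof (rule ccontr)
  assume "\<not> ?thesis"
  then have less: "\<bar>a - b\<bar> < \<bar>x - y\<bar>" if "a \<in> A" "b \<in> B" for a b using that by force
  define w where "w = \<bar>x - y\<bar>"
  have ne: "A \<noteq> {}" "B \<noteq> {}" using A B by auto
  then obtain a0 b0 where ab: "a0 \<in> A" "b0 \<in> B" by auto
  have "a \<le> b0 + w \<and> b0 - w \<le> a" if "a \<in> A" for a
    using less[OF that ab(2)] by (auto simp: w_def)
  then have bA: "bdd_above A" "bdd_below A" by (auto intro!: bdd_aboveI bdd_belowI)
  have "b \<le> a0 + w \<and> a0 - w \<le> b" if "b \<in> B" for b
    using less[OF ab(1) that] by (auto simp: w_def)
  then have bB: "bdd_above B" "bdd_below B" by (auto intro!: bdd_aboveI bdd_belowI)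
  have s1: "Sup A - Inf B \<le> w"
  proof -
    have "Sup A \<le> Inf B + w"
    proof (rule cSup_least[OF ne(1)])
      fix a assume a: "a \<in> A"
      have "a - w \<le> Inf B"
        by (rule cInf_greatest[OF ne(2)]) (use less[OF a] in \<open>force simp: w_def\<close>)
      then show "a \<le> Inf B + w" by simp
    qed
    then show ?thesis by simp
  qed
  have s2: "Sup B - Inf A \<le> w"
  proof -
    have "Sup B \<le> Inf A + w"
    proof (rule cSup_least[OF ne(2)])
      fix b assume b: "b \<in> B"
      have "b - w \<le> Inf A"
        by (rule cInf_greatest[OF ne(1)]) (use less[OF _ b] in \<open>force simp: w_def\<close>)
      then show "b \<le> Inf A + w" by simp
    qed
    then show ?thesis by simp
  qed
  have "ennreal (2 * \<bar>x\<bar>) < ennreal (Sup A - Inf A)"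
    using A emeasure_le_length[OF ne(1), of "Inf A" "Sup A"] bA
    by (meson cInf_lower cSup_upper less_le_trans)
  moreover have "ennreal (2 * \<bar>y\<bar>) < ennreal (Sup B - Inf B)"
    using B emeasure_le_length[OF ne(2), of "Inf B" "Sup B"] bB
    by (meson cInf_lower cSup_upper less_le_trans)
  ultimately have "2 * \<bar>x\<bar> < Sup A - Inf A" "2 * \<bar>y\<bar> < Sup B - Inf B"
    by (simp_all add: ennreal_less_iff)
  with s1 s2 show False unfolding w_def by linarith
qed

lemma steiner_distance:
  assumes I: "finite I" and i: "i \<in> I"
    and C: "\<And>f g. f \<in> C \<Longrightarrow> g \<in> C \<Longrightarrow> (\<Sum>j\<in>I. (f j - g j)\<^sup>2) \<le> (d::real)"
    and f: "f \<in> steiner I i C" and g: "g \<in> steiner I i C"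
  shows "(\<Sum>j\<in>I. (f j - g j)\<^sup>2) \<le> d"
proof -
  obtain a b where ab: "f(i := a) \<in> C" "g(i := b) \<in> C" "\<bar>f i - g i\<bar> \<le> \<bar>a - b\<bar>"
    using far_points_in_sections[of "f i" "{t. f(i := t) \<in> C}" "g i" "{t. g(i := t) \<in> C}"] f g
    by (auto simp: steiner_def)
  have "(\<Sum>j\<in>I. (f j - g j)\<^sup>2) \<le> (\<Sum>j\<in>I. ((f(i := a)) j - (g(i := b)) j)\<^sup>2)"
    using ab(3) by (intro sum_mono) (auto simp: abs_le_square_iff)
  also have "\<dots> \<le> d" by (rule C[OF ab(1,2)])
  finally show ?thesis .
qed

lemma steiner_symmetric:
  assumes "f \<in> steiner I i C" "i \<in> I"
  shows "f(i := - f i) \<in> steiner I i C"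
  using assms by (auto simp: steiner_def PiE_iff extensional_def)

lemma steiner_preserves_symmetry:
  assumes sym: "\<And>f. f \<in> C \<Longrightarrow> f(j := - f j) \<in> C" and "j \<in> I" "j \<noteq> i" "f \<in> steiner I i C"
  shows "f(j := - f j) \<in> steiner I i C"
proof -
  have "f(j := - f j, i := t) \<in> C \<longleftrightarrow> f(i := t) \<in> C" for t
    using sym[of "f(i := t)"] sym[of "f(j := - f j, i := t)"] \<open>j \<noteq> i\<close>
      fun_upd_idem[of "f(i := t)" j "f j"]
    by (auto simp: fun_upd_twist[of j i])
  with assms show ?thesis by (auto simp: steiner_def PiE_iff extensional_def)
qed

text \<open>
  Symmetrising in one direction keeps the symmetries gained before, so the directions can be treated
  one after the other.
\<close>
lemma iterated_steiner:
  assumes I: "finite I" and C: "C \<in> sets (Pi\<^sub>M I (\<lambda>_. lborel :: real measure))"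
    and dC: "\<And>f g. f \<in> C \<Longrightarrow> g \<in> C \<Longrightarrow> (\<Sum>j\<in>I. (f j - g j)\<^sup>2) \<le> (d::real)"
    and J: "J \<subseteq> I"
  shows "\<exists>D\<in>sets (Pi\<^sub>M I (\<lambda>_. lborel)).
     emeasure (Pi\<^sub>M I (\<lambda>_. lborel)) D = emeasure (Pi\<^sub>M I (\<lambda>_. lborel)) C \<and>
     (\<forall>f\<in>D. \<forall>g\<in>D. (\<Sum>j\<in>I. (f j - g j)\<^sup>2) \<le> d) \<and>
     (\<forall>j\<in>J. \<forall>f\<in>D. f(j := - f j) \<in> D)"
  using finite_subset[OF J I] J
proof (induction J rule: finite_induct)
  case empty
  then show ?case using C dC by auto
next
  case (insert i J)
  then obtain D where D: "D \<in> sets (Pi\<^sub>M I (\<lambda>_. lborel))"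
     "emeasure (Pi\<^sub>M I (\<lambda>_. lborel)) D = emeasure (Pi\<^sub>M I (\<lambda>_. lborel)) C"
     "\<And>f g. f \<in> D \<Longrightarrow> g \<in> D \<Longrightarrow> (\<Sum>j\<in>I. (f j - g j)\<^sup>2) \<le> d"
     "\<And>j f. j \<in> J \<Longrightarrow> f \<in> D \<Longrightarrow> f(j := - f j) \<in> D"
    by blast
  have i: "i \<in> I" and J: "J \<subseteq> I" using insert.prems by auto
  show ?case
  proof (intro bexI conjI ballI)
    show "steiner I i D \<in> sets (Pi\<^sub>M I (\<lambda>_. lborel))" by (rule sets_steiner[OF D(1) i])
    show "emeasure (Pi\<^sub>M I (\<lambda>_. lborel)) (steiner I i D) = emeasure (Pi\<^sub>M I (\<lambda>_. lborel)) C"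
      using emeasure_steiner[OF I D(1) i] D(2) by simp
    show "(\<Sum>j\<in>I. (f j - g j)\<^sup>2) \<le> d" if "f \<in> steiner I i D" "g \<in> steiner I i D" for f g
      using steiner_distance[OF I i D(3) that] .
    show "f(j := - f j) \<in> steiner I i D" if "j \<in> insert i J" "f \<in> steiner I i D" for j f
      using that steiner_symmetric[OF that(2) i] steiner_preserves_symmetry[OF D(4), of j I i f] J
        insert.hyps by auto
  qed
qed

text \<open>
  After symmetrisation in all directions the set is invariant under \<open>f \<mapsto> - f\<close>, so \<open>2 * norm f \<le> d\<close> for
  each of its points: it lies in a ball of radius \<open>d / 2\<close>.
\<close>
lemma isodiametric_PiM:
  assumes I: "finite I" and C: "C \<in> sets (Pi\<^sub>M I (\<lambda>_. lborel :: real measure))"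
    and d: "0 < d" and dC: "\<And>f g. f \<in> C \<Longrightarrow> g \<in> C \<Longrightarrow> (\<Sum>j\<in>I. (f j - g j)\<^sup>2) \<le> d\<^sup>2"
  shows "emeasure (Pi\<^sub>M I (\<lambda>_. lborel)) C \<le> ennreal (unit_ball_vol (real (card I)) * (d / 2) ^ card I)"
proof -
  obtain D where D: "D \<in> sets (Pi\<^sub>M I (\<lambda>_. lborel))"
     "emeasure (Pi\<^sub>M I (\<lambda>_. lborel)) D = emeasure (Pi\<^sub>M I (\<lambda>_. lborel)) C"
     "\<And>f g. f \<in> D \<Longrightarrow> g \<in> D \<Longrightarrow> (\<Sum>j\<in>I. (f j - g j)\<^sup>2) \<le> d\<^sup>2"
     "\<And>j f. j \<in> I \<Longrightarrow> f \<in> D \<Longrightarrow> f(j := - f j) \<in> D"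
    using iterated_steiner[OF I C dC order_refl] by blast
  have neg: "(\<lambda>j. if j \<in> J then - f j else f j) \<in> D" if f: "f \<in> D" and J: "J \<subseteq> I" for f J
    using finite_subset[OF J I] J
  proof (induction J rule: finite_induct)
    case empty
    then show ?case using f by simp
  next
    case (insert i J)
    have "(\<lambda>j. if j \<in> insert i J then - f j else f j) =
      (\<lambda>j. if j \<in> J then - f j else f j)(i := - (if i \<in> J then - f i else f i))"
      using insert.hyps by auto
    then show ?case using D(4)[of i "\<lambda>j. if j \<in> J then - f j else f j"] insert by simp
  qed
  have "D \<subseteq> {f. sqrt (\<Sum>i\<in>I. (f i)\<^sup>2) \<le> d / 2} \<inter> space (Pi\<^sub>M I (\<lambda>_. lborel))"
  proof
    fix f assume f: "f \<in> D"
    have "(\<Sum>j\<in>I. (f j - (if j \<in> I then - f j else f j))\<^sup>2) \<le> d\<^sup>2"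
      by (rule D(3)[OF f neg[OF f order_refl]])
    also have "(\<Sum>j\<in>I. (f j - (if j \<in> I then - f j else f j))\<^sup>2) = 4 * (\<Sum>j\<in>I. (f j)\<^sup>2)"
      by (simp add: sum_distrib_left power2_eq_square)
    finally have "(\<Sum>j\<in>I. (f j)\<^sup>2) \<le> (d / 2)\<^sup>2" by (simp add: power_divide)
    then show "f \<in> {f. sqrt (\<Sum>i\<in>I. (f i)\<^sup>2) \<le> d / 2} \<inter> space (Pi\<^sub>M I (\<lambda>_. lborel))"
      using d sets.sets_into_space[OF D(1)] f real_sqrt_le_mono[of "\<Sum>j\<in>I. (f j)\<^sup>2" "(d / 2)\<^sup>2"]
      by auto
  qed
  moreover have "{f. sqrt (\<Sum>i\<in>I. (f i)\<^sup>2) \<le> d / 2} \<inter> space (Pi\<^sub>M I (\<lambda>_. lborel)) \<in> sets (Pi\<^sub>M I (\<lambda>_. lborel :: real measure))"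
  proof -
    have "(\<lambda>f. sqrt (\<Sum>i\<in>I. (f i)\<^sup>2)) \<in> borel_measurable (Pi\<^sub>M I (\<lambda>_. lborel :: real measure))"
      by (intro borel_measurable_sqrt measurable_compose[OF borel_measurable_sum] borel_measurable_sum borel_measurable_power)
         (auto intro: measurable_component_singleton)
    then have "{f \<in> space (Pi\<^sub>M I (\<lambda>_. lborel :: real measure)). sqrt (\<Sum>i\<in>I. (f i)\<^sup>2) \<le> d / 2} \<in> sets (Pi\<^sub>M I (\<lambda>_. lborel :: real measure))"
      by measurable
    then show ?thesis by (simp add: Int_def conj_commute)
  qed
  ultimately have "emeasure (Pi\<^sub>M I (\<lambda>_. lborel)) D \<le>
      emeasure (Pi\<^sub>M I (\<lambda>_. lborel)) ({f. sqrt (\<Sum>i\<in>I. (f i)\<^sup>2) \<le> d / 2} \<inter> space (Pi\<^sub>M I (\<lambda>_. lborel :: real measure)))"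
    by (rule emeasure_mono)
  then show ?thesis using emeasure_cball_aux[OF I, of "d / 2"] d D(2) by simp
qed

theorem isodiametric:
  fixes C :: "'a::euclidean_space set"
  assumes C: "bounded C" "C \<in> sets borel" and d: "diameter C \<le> d"
  shows "emeasure lborel C \<le> ennreal (unit_ball_vol (real DIM('a)) * (d / 2) ^ DIM('a))"
proof -
  \<comment> \<open>Balls of radius 0 are excluded in \<open>isodiametric_PiM\<close>, so \<open>d\<close> is approached from above.\<close>
  have pos: "emeasure lborel C \<le> ennreal (unit_ball_vol (real DIM('a)) * (r / 2) ^ DIM('a))"
    if r: "diameter C < r" for r
  proof -
    let ?P = "Pi\<^sub>M (Basis :: 'a set) (\<lambda>_. lborel :: real measure)"
    let ?h = "\<lambda>f. \<Sum>b\<in>Basis. f b *\<^sub>R b :: 'a"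
    have r0: "0 < r" using r diameter_ge_0[OF C(1)] by linarith
    have h: "?h \<in> ?P \<rightarrow>\<^sub>M borel" by measurable
    define C' where "C' = ?h -` C \<inter> space ?P"
    have "emeasure lborel C = emeasure (distr ?P borel ?h) C"
      by (simp add: lborel_eq[symmetric])
    also have "\<dots> = emeasure ?P C'"
      unfolding C'_def using h C(2) by (rule emeasure_distr)
    also have "\<dots> \<le> ennreal (unit_ball_vol (real DIM('a)) * (r / 2) ^ DIM('a))"
    proof (rule isodiametric_PiM)
      show "C' \<in> sets ?P" unfolding C'_def using h C(2) by (rule measurable_sets)
      fix f g assume "f \<in> C'" "g \<in> C'"
      then have "dist (?h f) (?h g) \<le> r"
        using diameter_bounded_bound[OF C(1), of "?h f" "?h g"] r by (auto simp: C'_def)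
      moreover have "dist (?h f) (?h g) = sqrt (\<Sum>b\<in>Basis. (f b - g b)\<^sup>2)"
        by (subst euclidean_dist_l2) (auto simp: L2_set_def dist_real_def)
      ultimately show "(\<Sum>b\<in>Basis. (f b - g b)\<^sup>2) \<le> r\<^sup>2"
        using sqrt_le_D by auto
    qed (use r0 in auto)
    finally show ?thesis .
  qed
  have "((\<lambda>r. ennreal (unit_ball_vol (real DIM('a)) * (r / 2) ^ DIM('a)))
      \<longlongrightarrow> ennreal (unit_ball_vol (real DIM('a)) * (d / 2) ^ DIM('a))) (at_right d)"
    by (intro tendsto_intros) simp_all
  then show ?thesis
    by (rule tendsto_lowerbound)
       (use d in \<open>auto intro!: pos eventually_mono[OF eventually_at_right_less[of d]]\<close>)
qed

section \<open>Hausdorff measure of full dimension is Lebesgue measure\<close>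

lemma hausdorff_premeasure_Un:
  "hausdorff_premeasure k \<delta> (A \<union> B) \<le> hausdorff_premeasure k \<delta> A + hausdorff_premeasure k \<delta> B"
  if \<delta>: "0 \<le> \<delta>"
proof -
  let ?f = "\<lambda>i::nat. if i = 0 then A else if i = 1 then B else {}"
  have zero: "hausdorff_premeasure k \<delta> ({} :: 'a set) = 0"
  proof -
    have "hausdorff_premeasure k \<delta> ({} :: 'a set) \<le> (\<Sum>i. ennreal (hausdorff_weight k ({} :: 'a set)))"
      unfolding hausdorff_premeasure_def
      by (rule INF_lower) (use \<delta> in \<open>auto simp: hausdorff_covers_def\<close>)
    then show ?thesis by simp
  qed
  have "A \<union> B \<subseteq> (\<Union>i. ?f i)"
    using UN_upper[of 0 UNIV ?f] UN_upper[of 1 UNIV ?f] by simp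
  then have "hausdorff_premeasure k \<delta> (A \<union> B) \<le> (\<Sum>i. hausdorff_premeasure k \<delta> (?f i))"
    by (rule order_trans[OF hausdorff_premeasure_mono hausdorff_premeasure_UN])
  also have "\<dots> = (\<Sum>i\<in>{0, 1}. hausdorff_premeasure k \<delta> (?f i))"
    by (rule suminf_finite) (auto simp: zero)
  finally show ?thesis by simp
qed

text \<open>
  By the isodiametric inequality each set of a cover has at most the Lebesgue measure that
  \<open>hausdorff_weight\<close> assigns to it.
\<close>
lemma lborel_le_hausdorff_outer_measure:
  fixes A :: "'a::euclidean_space set"
  assumes A: "A \<in> sets borel"
  shows "emeasure lborel A \<le> hausdorff_outer_measure DIM('a) A"
proof -
  have "emeasure lborel A \<le> hausdorff_premeasure DIM('a) 1 A"
    unfolding hausdorff_premeasure_def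
  proof (rule INF_greatest)
    fix C assume C: "C \<in> hausdorff_covers 1 A"
    have "A \<subseteq> (\<Union>i. closure (C i))"
    proof -
      have "A \<subseteq> (\<Union>i. C i)" using C by (auto simp: hausdorff_covers_def)
      also have "\<dots> \<subseteq> (\<Union>i. closure (C i))" by (intro UN_mono closure_subset) auto
      finally show ?thesis .
    qed
    then have "emeasure lborel A \<le> emeasure lborel (\<Union>i. closure (C i))"
      by (intro emeasure_mono) auto
    also have "\<dots> \<le> (\<Sum>i. emeasure lborel (closure (C i)))"
      by (rule emeasure_subadditive_countably) auto
    also have "\<dots> \<le> (\<Sum>i. ennreal (hausdorff_weight DIM('a) (C i)))"
    proof (intro suminf_le)
      fix i
      have b: "bounded (C i)" using C by (auto simp: hausdorff_covers_def)
      show "emeasure lborel (closure (C i)) \<le> ennreal (hausdorff_weight DIM('a) (C i))"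
        using isodiametric[of "closure (C i)" "diameter (C i)"] b diameter_closure[OF b]
        by (auto simp: hausdorff_weight_def)
    qed auto
    finally show "emeasure lborel A \<le> (\<Sum>i. ennreal (hausdorff_weight DIM('a) (C i)))" .
  qed
  also have "\<dots> \<le> hausdorff_outer_measure DIM('a) A"
    unfolding hausdorff_outer_measure_def by (intro SUP_upper) auto
  finally show ?thesis .
qed

text \<open>
  Covers are sequences of sets. A countable and possibly finite family becomes a sequence by
  padding with \<open>None\<close>, which later stands for the empty set.
\<close>
lemma countable_nat_indexing:
  assumes "countable K"
  obtains g :: "nat \<Rightarrow> 'i option" where
    "\<And>n i. g n = Some i \<Longrightarrow> i \<in> K" "\<And>i. i \<in> K \<Longrightarrow> \<exists>n. g n = Some i"
    "\<And>n m i. g n = Some i \<Longrightarrow> g m = Some i \<Longrightarrow> n = m"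
proof
  define g where "g n = (if n \<in> to_nat_on K ` K then Some (from_nat_into K n) else None)" for n
  have *: "g n = Some i \<longleftrightarrow> i \<in> K \<and> n = to_nat_on K i" for n i
    using from_nat_into_to_nat_on[OF assms] by (auto simp: g_def)
  show "\<And>n i. g n = Some i \<Longrightarrow> i \<in> K" "\<And>i. i \<in> K \<Longrightarrow> \<exists>n. g n = Some i"
    "\<And>n m i. g n = Some i \<Longrightarrow> g m = Some i \<Longrightarrow> n = m"
    by (auto simp: *)
qed

text \<open>
  The enlargement factor \<open>c\<close> is 1 for covers that exhaust an open set up to a null set, and 5 for the
  covers of null sets that the basic Vitali lemma provides.
\<close>
lemma hausdorff_premeasure_enlarged_balls:
  fixes K :: "('a::euclidean_space \<times> real) set"
  assumes K: "countable K" and c: "0 < c"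
    and r: "\<And>x r. (x, r) \<in> K \<Longrightarrow> 0 < r \<and> 2 * (c * r) \<le> \<delta>" and \<delta>: "0 \<le> \<delta>"
    and disj: "pairwise (\<lambda>i j. disjnt (cball (fst i) (snd i)) (cball (fst j) (snd j))) K"
    and T: "\<And>x r. (x, r) \<in> K \<Longrightarrow> cball x r \<subseteq> T" and sT: "T \<in> sets borel"
  shows "hausdorff_premeasure DIM('a) \<delta> (\<Union>i\<in>K. cball (fst i) (c * snd i))
    \<le> ennreal (c ^ DIM('a)) * emeasure lborel T"
proof -
  obtain g :: "nat \<Rightarrow> ('a \<times> real) option" where g:
    "\<And>n i. g n = Some i \<Longrightarrow> i \<in> K" "\<And>i. i \<in> K \<Longrightarrow> \<exists>n. g n = Some i"
    "\<And>n m i. g n = Some i \<Longrightarrow> g m = Some i \<Longrightarrow> n = m"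
    by (rule countable_nat_indexing[OF K]) blast
  define B where "B c n = (case g n of None \<Rightarrow> {} | Some i \<Rightarrow> cball (fst i) (c * snd i))" for c n
  have diam: "diameter (cball x (c * s)) = 2 * (c * s)" if "(x, s) \<in> K" for x s
    
  proof -
    have "0 \<le> c * s" using r[OF that] c by simp
    then show ?thesis using diameter_cball[of x "c * s"] by (simp only: not_less[symmetric] if_False)
  qed
  have "(\<Union>i\<in>K. cball (fst i) (c * snd i)) \<subseteq> (\<Union>n. B c n)"
  proof safe
    fix x s y assume K: "(x, s) \<in> K" and y: "y \<in> cball (fst (x, s)) (c * snd (x, s))"
    obtain n where "g n = Some (x, s)" using g(2)[OF K] by auto
    then have "y \<in> B c n" using y by (simp add: B_def)
    then show "y \<in> (\<Union>n. B c n)" by blast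
  qed
  moreover have "bounded (B c n) \<and> diameter (B c n) \<le> \<delta>" for n
  proof (cases "g n")
    case (Some i)
    then show ?thesis
      using g(1)[OF Some] diam[of "fst i" "snd i"] r[of "fst i" "snd i"] by (simp add: B_def)
  qed (use \<delta> in \<open>simp add: B_def\<close>)
  ultimately have "B c \<in> hausdorff_covers \<delta> (\<Union>i\<in>K. cball (fst i) (c * snd i))"
    by (simp add: hausdorff_covers_def)
  then have "hausdorff_premeasure DIM('a) \<delta> (\<Union>i\<in>K. cball (fst i) (c * snd i))
      \<le> (\<Sum>n. ennreal (hausdorff_weight DIM('a) (B c n)))"
    unfolding hausdorff_premeasure_def by (rule INF_lower)
  also have "\<dots> = (\<Sum>n. ennreal (c ^ DIM('a)) * emeasure lborel (B 1 n))"
  proof (rule suminf_cong)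
    fix n
    show "ennreal (hausdorff_weight DIM('a) (B c n)) = ennreal (c ^ DIM('a)) * emeasure lborel (B 1 n)"
    proof (cases "g n")
      case None
      then show ?thesis by (simp add: B_def)
    next
      case (Some i)
      obtain x s where i: "i = (x, s)" by (cases i)
      have K: "(x, s) \<in> K" using g(1) Some i by simp
      have "cball x (c * s) \<noteq> {}" using r[OF K] c by (simp add: not_less)
      then show ?thesis using Some i diam[OF K] r[OF K] c
        by (simp add: B_def hausdorff_weight_def emeasure_cball ennreal_mult'[symmetric]
            power_mult_distrib mult.left_commute)
    qed
  qed
  also have "\<dots> = ennreal (c ^ DIM('a)) * (\<Sum>n. emeasure lborel (B 1 n))" by simp
  also have "(\<Sum>n. emeasure lborel (B 1 n)) = emeasure lborel (\<Union>n. B 1 n)"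
  proof (rule suminf_emeasure)
    show "range (B 1) \<subseteq> sets lborel" by (auto simp: B_def split: option.split)
    show "disjoint_family (B 1)"
      unfolding disjoint_family_on_def
    proof (intro ballI impI)
      fix m n :: nat assume mn: "m \<noteq> n"
      show "B 1 m \<inter> B 1 n = {}"
      proof (cases "g m"; cases "g n")
        fix i j assume ij: "g m = Some i" "g n = Some j"
        then have "i \<noteq> j" using g(3) mn by blast
        then have "disjnt (cball (fst i) (snd i)) (cball (fst j) (snd j))"
          using disj g(1) ij by (auto simp: pairwise_def)
        then show ?thesis using ij by (simp add: B_def disjnt_def)
      qed (auto simp: B_def)
    qed
  qed
  also have "emeasure lborel (\<Union>n. B 1 n) \<le> emeasure lborel T"
  proof (rule emeasure_mono)
    show "(\<Union>n. B 1 n) \<subseteq> T"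
    proof (rule UN_least)
      fix n
      show "B 1 n \<subseteq> T"
      proof (cases "g n")
        case (Some i)
        then show ?thesis using T[of "fst i" "snd i"] g(1)[OF Some] by (simp add: B_def)
      qed (simp add: B_def)
    qed
  qed (use sT in simp)
  finally show ?thesis by (simp add: mult_left_mono)
qed

text \<open>
  A null set lies in an open set of small measure. Disjoint balls inside the latter have small total
  weight, and after enlargement by the factor 5 they cover the null set.
\<close>
lemma hausdorff_premeasure_negligible:
  fixes N :: "'a::euclidean_space set"
  assumes N: "negligible N" and \<delta>: "0 < \<delta>"
  shows "hausdorff_premeasure DIM('a) \<delta> N = 0"
proof -
  define c where "c = (5 ^ DIM('a) :: real)"
  have c: "0 < c" by (simp add: c_def)
  have le: "hausdorff_premeasure DIM('a) \<delta> N \<le> ennreal e" if e: "0 < e" for e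
  proof -
    have Nl: "N \<in> sets lebesgue" "emeasure lebesgue N = 0"
      using N by (auto simp: negligible_iff_null_sets)
    obtain T where T: "open T" "N \<subseteq> T" "emeasure lebesgue (T - N) < ennreal (e / c)"
      using sets_lebesgue_outer_open[OF Nl(1) divide_pos_pos[OF e c]] by metis
    have "emeasure lborel T = emeasure lebesgue T" using T(1) by simp
    also have "\<dots> \<le> emeasure lebesgue (T - N) + emeasure lebesgue N"
    proof -
      have "T - N \<in> sets lebesgue" using T(1) Nl(1) by (intro sets.Diff) auto
      from emeasure_subadditive[OF this Nl(1)] T(2) show ?thesis
        by (simp add: Un_absorb2)
    qed
    also have "\<dots> \<le> ennreal (e / c)" using T(3) Nl(2) by simp
    finally have Te: "emeasure lborel T \<le> ennreal (e / c)" .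
    \<comment> \<open>The balls are enlarged 5 times and must then have diameter at most \<open>\<delta>\<close>.\<close>
    define K where "K = {(x, r). x \<in> N \<and> 0 < r \<and> r \<le> \<delta> / 10 \<and> cball x r \<subseteq> T}"
    have cover: "N \<subseteq> (\<Union>i\<in>K. cball (fst i) (snd i))"
    proof
      fix x assume x: "x \<in> N"
      then obtain d where d: "0 < d" "cball x d \<subseteq> T"
        using T(1,2) open_contains_cball by blast
      have "(x, min d (\<delta> / 10)) \<in> K"
        using x d \<delta> by (auto simp: K_def)
      then show "x \<in> (\<Union>i\<in>K. cball (fst i) (snd i))"
        using d \<delta> by (intro UN_I) auto
    qed
    obtain L where L: "countable L" "L \<subseteq> K"
      "pairwise (\<lambda>i j. disjnt (cball (fst i) (snd i)) (cball (fst j) (snd j))) L"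
      "N \<subseteq> (\<Union>i\<in>L. cball (fst i) (5 * snd i))"
    proof (rule Vitali_covering_lemma_cballs[OF cover])
      show "0 < snd i \<and> snd i \<le> \<delta> / 10" if "i \<in> K" for i using that by (auto simp: K_def)
    qed
    have "hausdorff_premeasure DIM('a) \<delta> N \<le> hausdorff_premeasure DIM('a) \<delta> (\<Union>i\<in>L. cball (fst i) (5 * snd i))"
      by (rule hausdorff_premeasure_mono[OF L(4)])
    also have "\<dots> \<le> ennreal c * emeasure lborel T"
      unfolding c_def
    proof (rule hausdorff_premeasure_enlarged_balls[OF L(1) _ _ _ L(3)])
      show "0 < r \<and> 2 * (5 * r) \<le> \<delta>" "cball x r \<subseteq> T" if "(x, r) \<in> L" for x r
        using that L(2) by (auto simp: K_def)
    qed (use \<delta> T in auto)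
    also have "\<dots> \<le> ennreal c * ennreal (e / c)" by (intro mult_left_mono Te) auto
    also have "\<dots> = ennreal e" using e c by (simp add: ennreal_mult'[symmetric])
    finally show ?thesis .
  qed
  have "hausdorff_premeasure DIM('a) \<delta> N \<le> 0"
    by (rule ennreal_le_epsilon) (simp add: le)
  then show ?thesis by simp
qed

text \<open>
  Balls are the sets for which the weight is exactly the volume, and by Vitali's theorem disjoint small
  balls fill an open set up to a null set. Borel sets follow by outer regularity.
\<close>
lemma hausdorff_outer_measure_le_lborel:
  fixes A :: "'a::euclidean_space set"
  assumes A: "A \<in> sets borel"
  shows "hausdorff_outer_measure DIM('a) A \<le> emeasure lborel A"
proof -
  have op: "hausdorff_premeasure DIM('a) \<delta> T \<le> emeasure lborel T"
    if T: "open T" and \<delta>: "0 < \<delta>" for T :: "'a set" and \<delta>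
  proof -
    define K where "K = {(x, r). x \<in> T \<and> 0 < r \<and> r \<le> \<delta> / 2 \<and> cball x r \<subseteq> T}"
    obtain L where L: "countable L" "L \<subseteq> K"
      "pairwise (\<lambda>i j. disjnt (cball (fst i) (snd i)) (cball (fst j) (snd j))) L"
      "negligible (T - (\<Union>i\<in>L. cball (fst i) (snd i)))"
    proof (rule Vitali_covering_theorem_cballs[of K snd T fst])
      show "0 < snd i" if "i \<in> K" for i using that by (auto simp: K_def)
      fix x d assume x: "x \<in> T" and d: "0 < (d::real)"
      obtain s where s: "0 < s" "cball x s \<subseteq> T"
        using T x open_contains_cball by blast
      let ?r = "min s (min (\<delta> / 2) (d / 2))"
      have "(x, ?r) \<in> K"
        using x d \<delta> s by (auto simp: K_def)
      moreover have "x \<in> cball (fst (x, ?r)) (snd (x, ?r))" "snd (x, ?r) < d"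
        using s d \<delta> by auto
      ultimately show "\<exists>i. i \<in> K \<and> x \<in> cball (fst i) (snd i) \<and> snd i < d" by blast
    qed
    let ?U = "\<Union>i\<in>L. cball (fst i) (snd i)"
    have "hausdorff_premeasure DIM('a) \<delta> T \<le> hausdorff_premeasure DIM('a) \<delta> (?U \<union> (T - ?U))"
      by (rule hausdorff_premeasure_mono) auto
    also have "\<dots> \<le> hausdorff_premeasure DIM('a) \<delta> ?U + hausdorff_premeasure DIM('a) \<delta> (T - ?U)"
      using \<delta> by (intro hausdorff_premeasure_Un) auto
    also have "\<dots> = hausdorff_premeasure DIM('a) \<delta> ?U"
      using hausdorff_premeasure_negligible[OF L(4) \<delta>] by simp
    also have "\<dots> \<le> emeasure lborel T"
    proof -
      have "0 < r \<and> 2 * (1 * r) \<le> \<delta>" "cball x r \<subseteq> T" if "(x, r) \<in> L" for x r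
        using that L(2) by (auto simp: K_def)
      from hausdorff_premeasure_enlarged_balls[of L 1 \<delta> T, OF L(1) _ this(1) _ L(3) this(2)]
      show ?thesis using T \<delta> by simp
    qed
    finally show ?thesis .
  qed
  show ?thesis
  proof (rule ennreal_le_epsilon)
    fix e :: real assume e: "0 < e"
    obtain T where T: "open T" "A \<subseteq> T" "emeasure lborel (T - A) < e"
      using outer_regular_lborel[OF A e] .
    have "hausdorff_outer_measure DIM('a) A \<le> hausdorff_outer_measure DIM('a) T"
      by (rule hausdorff_outer_measure_mono[OF T(2)])
    also have "\<dots> \<le> emeasure lborel T"
      unfolding hausdorff_outer_measure_def using op[OF T(1)] by (intro SUP_least) auto
    also have "\<dots> \<le> emeasure lborel A + emeasure lborel (T - A)"
      using emeasure_subadditive[of A lborel "T - A"] A T(1,2) by (simp add: Un_absorb1)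
    also have "\<dots> \<le> emeasure lborel A + ennreal e"
      using T(3) by (intro add_left_mono) simp
    finally show "hausdorff_outer_measure DIM('a) A \<le> emeasure lborel A + ennreal e" .
  qed
qed

theorem hausdorff_outer_measure_eq_lborel:
  fixes A :: "'a::euclidean_space set"
  assumes "A \<in> sets borel"
  shows "hausdorff_outer_measure DIM('a) A = emeasure lborel A"
  using assms by (intro antisym hausdorff_outer_measure_le_lborel lborel_le_hausdorff_outer_measure)

lemma hausdorff_outer_measure_isometry:
  fixes f :: "'a::metric_space \<Rightarrow> 'b::metric_space"
  assumes iso: "\<And>x y. dist (f x) (f y) = dist x y"
  shows "hausdorff_outer_measure k (f ` A) = hausdorff_outer_measure k A"
proof (rule antisym)
  show "hausdorff_outer_measure k (f ` A) \<le> hausdorff_outer_measure k A"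
    using hausdorff_outer_measure_Lipschitz_image[of 1 A f k] iso by simp
  have inj: "inj f" using iso by (metis dist_eq_0_iff injI)
  have "dist (inv f x) (inv f y) \<le> 1 * dist x y" if "x \<in> f ` A" "y \<in> f ` A" for x y
    using that iso inj by auto
  from hausdorff_outer_measure_Lipschitz_image[of 1 "f ` A" "inv f" k, OF _ this]
  have "hausdorff_outer_measure k (inv f ` f ` A) \<le> hausdorff_outer_measure k (f ` A)"
    by simp
  then show "hausdorff_outer_measure k A \<le> hausdorff_outer_measure k (f ` A)"
    using inj by (simp add: image_comp)
qed

lemma linear_isometry_surj:
  fixes L :: "'a::euclidean_space \<Rightarrow> 'b::euclidean_space"
  assumes DIM: "DIM('a) = DIM('b)" and lin: "linear L" and iso: "\<And>x. norm (L x) = norm x"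
  shows "surj L"
proof -
  have "inj L" unfolding linear_injective_0[OF lin] using iso norm_eq_zero by metis
  then have "dim (range L) = DIM('b)"
    using dim_image_eq[OF lin, of UNIV] DIM by simp
  then have "span (range L) = UNIV" by (simp add: dim_eq_full)
  moreover have "span (range L) = range L"
    using linear_subspace_image[OF lin subspace_UNIV] by (simp add: span_eq_iff)
  ultimately show ?thesis by simp
qed

text \<open>
  Hausdorff measure is visibly invariant under isometries, also between different spaces; since it
  equals Lebesgue measure, the latter inherits this.
\<close>
lemma emeasure_lborel_linear_isometry:
  fixes L :: "'a::euclidean_space \<Rightarrow> 'b::euclidean_space"
  assumes DIM: "DIM('a) = DIM('b)" and lin: "linear L" and iso: "\<And>x. norm (L x) = norm x"
    and A: "A \<in> sets borel"
  shows "L ` A \<in> sets borel" "emeasure lborel (L ` A) = emeasure lborel A"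
proof -
  have d: "dist (L x) (L y) = dist x y" for x y
    using iso[of "x - y"] lin by (simp add: dist_norm linear_diff)
  have inj: "inj L" using d by (metis dist_eq_0_iff injI)
  have surj: "surj L" by (rule linear_isometry_surj[OF DIM lin iso])
  have "dist (inv L x) (inv L y) = dist x y" for x y
    using d[of "inv L x" "inv L y"] surj by (simp add: surj_f_inv_f)
  then have "continuous_on UNIV (inv L)"
    unfolding continuous_on_iff by auto
  then have m: "inv L \<in> borel \<rightarrow>\<^sub>M borel"
    by (rule borel_measurable_continuous_onI)
  have "inv L -` A = L ` A" 
  proof (intro equalityI subsetI)
    fix x assume "x \<in> inv L -` A"
    then show "x \<in> L ` A" using surj surj_f_inv_f[of L x] by (metis imageI vimageD)
  qed (use inj in auto)
  then show B: "L ` A \<in> sets borel" using measurable_sets[OF m A] by simp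
  show "emeasure lborel (L ` A) = emeasure lborel A"
    using hausdorff_outer_measure_eq_lborel[OF A] hausdorff_outer_measure_eq_lborel[OF B]
      hausdorff_outer_measure_isometry[of L "DIM('a)" A] d DIM by simp
qed

section \<open>Cones over flat sets\<close>

text \<open>
  The parameter \<open>t\<close> is positive, so that a point of the cone determines its base point if every ray
  from the origin meets \<open>A\<close> at most once and \<open>0 \<notin> A\<close>.
\<close>
definition solid_cone :: "'a::real_vector set \<Rightarrow> 'a set" where
  "solid_cone A = {t *\<^sub>R a | t a. 0 < t \<and> t \<le> 1 \<and> a \<in> A}"

lemma solid_cone_linear_image:
  assumes "linear L" shows "solid_cone (L ` A) = L ` solid_cone A"
  using assms unfolding solid_cone_def by (force simp: linear_scale)

lemma emeasure_lborel_scale_vimage: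
  fixes Z :: "'a::euclidean_space set"
  assumes c: "0 < c" and Z: "Z \<in> sets borel"
  shows "emeasure lborel Z = ennreal (c ^ DIM('a)) * emeasure lborel {z. c *\<^sub>R z \<in> Z}"
proof -
  have "emeasure lborel Z = emeasure (density (distr lborel borel (\<lambda>x. 0 + c *\<^sub>R x)) (\<lambda>_. ennreal (\<bar>c\<bar> ^ DIM('a)))) Z"
    using lborel_affine[of c "0::'a"] c by simp
  also have "\<dots> = ennreal (\<bar>c\<bar> ^ DIM('a)) * emeasure (distr lborel borel (\<lambda>x. 0 + c *\<^sub>R x)) Z"
    using Z by (intro emeasure_density_const) simp
  also have "\<dots> = ennreal (c ^ DIM('a)) * emeasure lborel {z. c *\<^sub>R z \<in> Z}"
    using Z c by (subst emeasure_distr) (auto simp: vimage_def)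
  finally show ?thesis .
qed

lemma
  fixes Z :: "'b::euclidean_space set"
  assumes h: "0 < h" and Z: "Z \<in> sets borel"
  shows sets_solid_cone_flat: "solid_cone ({h} \<times> Z) \<in> sets borel"
    and emeasure_solid_cone_flat:
      "emeasure lborel (solid_cone ({h} \<times> Z)) = ennreal (h / (DIM('b) + 1)) * emeasure lborel Z"
proof -
  let ?k = "DIM('b)"
  define D where "D = {(s, z). 0 < s \<and> s \<le> h \<and> (h / s) *\<^sub>R z \<in> Z}"
  have eq: "solid_cone ({h} \<times> Z) = D"
  proof (intro equalityI subsetI)
    fix x assume "x \<in> solid_cone ({h} \<times> Z)"
    then show "x \<in> D" using h by (auto simp: solid_cone_def D_def)
  next
    fix x assume "x \<in> D"
    then obtain s z where x: "x = (s, z)" "0 < s" "s \<le> h" "(h / s) *\<^sub>R z \<in> Z" by (auto simp: D_def)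
    have "x = (s / h) *\<^sub>R (h, (h / s) *\<^sub>R z)" using x h by simp
    moreover have "0 < s / h" "s / h \<le> 1" using x h by auto
    ultimately show "x \<in> solid_cone ({h} \<times> Z)" using x(4) unfolding solid_cone_def by blast
  qed
  have m: "(\<lambda>p :: real \<times> 'b. (h / fst p) *\<^sub>R snd p) \<in> borel_measurable borel"
    by (simp add: borel_prod[symmetric])
  have m': "(fst :: real \<times> 'b \<Rightarrow> real) \<in> borel_measurable borel"
    by (intro borel_measurable_continuous_onI continuous_intros)
  have "fst -` {0<..h} \<inter> (\<lambda>p :: real \<times> 'b. (h / fst p) *\<^sub>R snd p) -` Z \<in> sets borel"
    using measurable_sets[OF m Z] measurable_sets[OF m', of "{0<..h}"] by (intro sets.Int) simp_all
  also have "fst -` {0<..h} \<inter> (\<lambda>p :: real \<times> 'b. (h / fst p) *\<^sub>R snd p) -` Z = D"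
    by (auto simp: D_def)
  finally have D: "D \<in> sets borel" .
  then show "solid_cone ({h} \<times> Z) \<in> sets borel" using eq by simp
  have slice: "emeasure lborel (Pair s -` D)
      = ennreal ((s / h) ^ ?k) * indicator {0..h} s * emeasure lborel Z" for s
  proof (cases "0 < s \<and> s \<le> h")
    case True
    then have c: "0 < h / s" by simp
    have "emeasure lborel Z = ennreal ((h / s) ^ ?k) * emeasure lborel {z. (h / s) *\<^sub>R z \<in> Z}"
      by (rule emeasure_lborel_scale_vimage[OF c Z])
    moreover have "Pair s -` D = {z. (h / s) *\<^sub>R z \<in> Z}" using True by (auto simp: D_def)
    moreover have "ennreal ((s / h) ^ ?k) * (ennreal ((h / s) ^ ?k) * X) = X" for X
      using True h by (simp add: mult.assoc[symmetric] ennreal_mult'[symmetric] power_mult_distrib[symmetric])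
    ultimately show ?thesis using True by simp
  next
    case False
    then have "Pair s -` D = {}" by (auto simp: D_def)
    moreover have "ennreal ((s / h) ^ ?k) * indicator {0..h} s = 0"
      using False by (cases "s = 0") (auto simp: indicator_def power_0_left)
    ultimately show ?thesis by simp
  qed
  have "emeasure lborel D = emeasure (lborel \<Otimes>\<^sub>M lborel) D" by (simp add: lborel_prod)
  also have "\<dots> = (\<integral>\<^sup>+ s. emeasure lborel (Pair s -` D) \<partial>lborel)"
    using D by (intro lborel.emeasure_pair_measure_alt) (simp only: lborel_prod sets_lborel)
  also have "\<dots> = (\<integral>\<^sup>+ s. ennreal ((s / h) ^ ?k) * indicator {0..h} s \<partial>lborel) * emeasure lborel Z"
    unfolding slice by (rule nn_integral_multc) measurable
  also have "(\<integral>\<^sup>+ s. ennreal ((s / h) ^ ?k) * indicator {0..h} s \<partial>lborel)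
      = ennreal (h / (?k + 1) * (h / h) ^ (?k + 1) - h / (?k + 1) * (0 / h) ^ (?k + 1))"
  proof (rule nn_integral_FTC_Icc)
    fix s :: real assume s: "s \<in> {0..h}"
    show "((\<lambda>s. h / (?k + 1) * (s / h) ^ (?k + 1)) has_real_derivative (s / h) ^ ?k) (at s)"
      by (rule derivative_eq_intros refl | use h in simp)+
    show "0 \<le> (s / h) ^ ?k" using s h by simp
  qed (use h in auto)
  finally show "emeasure lborel (solid_cone ({h} \<times> Z)) = ennreal (h / (?k + 1)) * emeasure lborel Z"
    using h eq by simp
qed

section \<open>Localisation of inequalities between measures\<close>

text \<open>
  Compactness gives a finite cover by balls on which the inequality holds; cutting a set along these
  balls gives finitely many disjoint pieces.
\<close>
lemma emeasure_le_if_locally: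
  fixes \<mu> \<nu> :: "'a::metric_space measure"
  assumes S: "compact S" and sets: "sets \<mu> = sets borel" "sets \<nu> = sets borel"
    and loc: "\<And>p. p \<in> S \<Longrightarrow>
      \<exists>r>0. \<forall>A\<in>sets borel. A \<subseteq> S \<inter> ball p r \<longrightarrow> emeasure \<mu> A \<le> c * emeasure \<nu> A"
    and A: "A \<in> sets borel" "A \<subseteq> S"
  shows "emeasure \<mu> A \<le> c * emeasure \<nu> A"
proof -
  obtain r where r: "\<And>p. p \<in> S \<Longrightarrow> 0 < r p"
    "\<And>p A. p \<in> S \<Longrightarrow> A \<in> sets borel \<Longrightarrow> A \<subseteq> S \<inter> ball p (r p) \<Longrightarrow> emeasure \<mu> A \<le> c * emeasure \<nu> A"
    using loc by metis
  have "S \<subseteq> (\<Union>p\<in>S. ball p (r p))" using r(1) by force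
  then obtain D where D: "D \<subseteq> S" "finite D" "S \<subseteq> (\<Union>p\<in>D. ball p (r p))"
    using compactE_image[OF S, of S "\<lambda>p. ball p (r p)"] by auto
  have "emeasure \<mu> A \<le> c * emeasure \<nu> A"
    if "A \<in> sets borel" "A \<subseteq> S \<inter> (\<Union>p\<in>D. ball p (r p))" for A
    using D(2,1) that
  proof (induction D arbitrary: A rule: finite_induct)
    case empty
    then show ?case by simp
  next
    case (insert p D)
    let ?B = "ball p (r p)"
    have m: "A \<inter> ?B \<in> sets borel" "A - ?B \<in> sets borel" using insert.prems by auto
    have split: "emeasure M A = emeasure M (A \<inter> ?B) + emeasure M (A - ?B)"
      if "sets M = sets borel" for M
    proof -
      have "(A \<inter> ?B) \<inter> (A - ?B) = {}" "(A \<inter> ?B) \<union> (A - ?B) = A" by blast+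
      then show ?thesis using plus_emeasure[of "A \<inter> ?B" M "A - ?B"] m that by simp
    qed
    have "emeasure \<mu> A \<le> c * emeasure \<nu> (A \<inter> ?B) + c * emeasure \<nu> (A - ?B)"
      unfolding split[OF sets(1)]
    proof (rule add_mono)
      show "emeasure \<mu> (A \<inter> ?B) \<le> c * emeasure \<nu> (A \<inter> ?B)"
        using insert.prems m by (intro r(2)[of p]) auto
      show "emeasure \<mu> (A - ?B) \<le> c * emeasure \<nu> (A - ?B)"
        using insert.prems m by (intro insert.IH) auto
    qed
    also have "\<dots> = c * emeasure \<nu> A" unfolding split[OF sets(2)] by (simp add: distrib_left)
    finally show ?case .
  qed
  then show ?thesis using A D(3) by blast
qed

lemma ennreal_le_if_le_near_one:
  fixes x y :: ennreal
  assumes le: "\<And>e. 0 < e \<Longrightarrow> x \<le> ennreal ((1 + e)\<^sup>2) * y"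
  shows "x \<le> y"
proof (cases y)
  case (real r)
  have "((\<lambda>e. ennreal ((1 + e)\<^sup>2 * r)) \<longlongrightarrow> ennreal ((1 + 0)\<^sup>2 * r)) (at_right 0)"
    by (intro tendsto_intros)
  moreover have "\<forall>\<^sub>F e in at_right 0. x \<le> ennreal ((1 + e)\<^sup>2 * r)"
    using eventually_at_right_less[of "0::real"]
    by eventually_elim (use le real in \<open>simp add: ennreal_mult\<close>)
  ultimately have "x \<le> ennreal ((1 + 0)\<^sup>2 * r)"
    by (rule tendsto_lowerbound) simp
  then show ?thesis using real by simp
qed simp

section \<open>The boundary of an ellipsoid near one of its points\<close>

text \<open>
  The ellipsoid is \<open>norm (Q x) \<le> 1\<close>. Taking \<open>Q\<close> to be the identity gives the unit ball, so that
  everything proved here applies to the sphere as well.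
\<close>
locale ellipsoid =
  fixes Q :: "'a::euclidean_space \<Rightarrow> 'a"
  assumes linear_Q: "linear Q" and Q_eq_0: "Q x = 0 \<Longrightarrow> x = 0"
begin

definition enorm :: "'a \<Rightarrow> real" where "enorm x = norm (Q x)"

definition surf :: "'a set" where "surf = {x. enorm x = 1}"

definition radial :: "'a \<Rightarrow> 'a" where "radial x = x /\<^sub>R enorm x"

text \<open>
  Half the gradient of \<open>(norm (Q x))\<^sup>2\<close>. At a boundary point \<open>p\<close> the tangent plane is
  \<open>normal p \<bullet> x = 1\<close>, at distance \<open>1 / norm (normal p)\<close> from the origin.
\<close>
definition normal :: "'a \<Rightarrow> 'a" where "normal x = adjoint Q (Q x)"

lemma linear_normal: "linear normal"
  using linear_compose[OF linear_Q adjoint_linear[OF linear_Q]]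
  by (simp add: normal_def[abs_def] o_def)

lemma normal_inner: "normal x \<bullet> y = Q x \<bullet> Q y"
  by (simp add: normal_def inner_commute adjoint_works[OF linear_Q])

lemma continuous_on_Q: "continuous_on A Q"
  by (rule linear_continuous_on) (simp add: linear_conv_bounded_linear[symmetric] linear_Q)

lemma continuous_on_normal: "continuous_on A normal"
  by (rule linear_continuous_on) (simp add: linear_conv_bounded_linear[symmetric] linear_normal)

lemma continuous_on_enorm: "continuous_on A enorm"
  unfolding enorm_def[abs_def] by (intro continuous_intros continuous_on_Q)

lemma measurable_enorm [measurable]: "enorm \<in> borel_measurable borel"
  by (rule borel_measurable_continuous_onI[OF continuous_on_enorm])

lemma measurable_normal [measurable]: "normal \<in> borel_measurable borel"
  by (rule borel_measurable_continuous_onI[OF continuous_on_normal])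

lemma measurable_radial [measurable]: "radial \<in> borel_measurable borel"
  unfolding radial_def[abs_def] by measurable

lemma enorm_0 [simp]: "enorm 0 = 0"
  by (simp add: enorm_def linear_0[OF linear_Q])

lemma enorm_nonneg [simp]: "0 \<le> enorm x" by (simp add: enorm_def)

lemma enorm_pos: "x \<noteq> 0 \<Longrightarrow> 0 < enorm x" using Q_eq_0 by (auto simp: enorm_def)

lemma enorm_scale: "enorm (t *\<^sub>R x) = \<bar>t\<bar> * enorm x"
  by (simp add: enorm_def linear_scale[OF linear_Q])

lemma enorm_radial: "x \<noteq> 0 \<Longrightarrow> enorm (radial x) = 1"
  using enorm_pos[of x] by (simp add: radial_def enorm_scale)

lemma radial_scale: "0 < t \<Longrightarrow> radial (t *\<^sub>R x) = radial x"
  by (simp add: radial_def enorm_scale)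

lemma radial_surf: "x \<in> surf \<Longrightarrow> radial x = x"
  by (simp add: surf_def radial_def)

lemma surf_nonzero: "x \<in> surf \<Longrightarrow> x \<noteq> 0"
  by (auto simp: surf_def)

lemma normal_inner_surf: "p \<in> surf \<Longrightarrow> normal p \<bullet> p = 1"
  by (simp add: normal_inner surf_def enorm_def norm_eq_1)

lemma normal_nonzero: "p \<in> surf \<Longrightarrow> normal p \<noteq> 0"
  using normal_inner_surf by force

lemma solid_cone_surf:
  assumes "A \<subseteq> surf"
  shows "solid_cone A = {x. enorm x \<le> 1 \<and> radial x \<in> A}"
proof (intro equalityI subsetI)
  fix x assume "x \<in> solid_cone A"
  then obtain t a where "x = t *\<^sub>R a" "0 < t" "t \<le> 1" "a \<in> A" by (auto simp: solid_cone_def)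
  then show "x \<in> {x. enorm x \<le> 1 \<and> radial x \<in> A}"
    using assms by (auto simp: enorm_scale radial_scale radial_surf subset_iff) (auto simp: surf_def)
next
  fix x assume x: "x \<in> {x. enorm x \<le> 1 \<and> radial x \<in> A}"
  then have "x \<noteq> 0" using assms surf_nonzero by (fastforce simp: radial_def)
  then have "x = enorm x *\<^sub>R radial x" "0 < enorm x" using enorm_pos[of x] by (simp_all add: radial_def)
  with x show "x \<in> solid_cone A" unfolding solid_cone_def by blast
qed

lemma sets_solid_cone_surf:
  assumes "A \<subseteq> surf" "A \<in> sets borel"
  shows "solid_cone A \<in> sets borel"
proof -
  have "{x. enorm x \<le> 1} \<inter> radial -` A \<in> sets borel"
    using measurable_sets[OF measurable_radial assms(2)] by (intro sets.Int) simp_all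
  also have "{x. enorm x \<le> 1} \<inter> radial -` A = solid_cone A"
    using solid_cone_surf[OF assms(1)] by auto
  finally show ?thesis .
qed

lemma enorm_triangle: "enorm (x + y) \<le> enorm x + enorm y"
  by (simp add: enorm_def linear_add[OF linear_Q] norm_triangle_ineq)

lemma enorm_diff_le: "\<bar>enorm x - enorm y\<bar> \<le> enorm (x - y)"
  by (simp add: enorm_def linear_diff[OF linear_Q] norm_triangle_ineq3)

text \<open>
  \<open>Q p\<close> and \<open>Q (x - p)\<close> are orthogonal when \<open>x\<close> lies in the tangent plane at \<open>p\<close>. On that plane
  \<open>enorm\<close> therefore differs from 1 only to second order.
\<close>
lemma enorm_tangent:
  assumes "p \<in> surf" "normal p \<bullet> x = 1"
  shows "(enorm x)\<^sup>2 = 1 + (enorm (x - p))\<^sup>2"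
proof -
  have "Q x = Q p + Q (x - p)" using linear_add[OF linear_Q, of p "x - p"] by simp
  moreover have "Q p \<bullet> Q (x - p) = 0"
    using assms normal_inner_surf[OF assms(1)] by (simp add: normal_inner[symmetric] inner_diff_right)
  moreover have "(norm (Q p))\<^sup>2 = 1" using assms(1) by (simp add: surf_def enorm_def)
  ultimately show ?thesis
    unfolding enorm_def using norm_add_Pythagorean[of "Q p" "Q (x - p)"] by (simp add: orthogonal_def)
qed

text \<open>
  Radial projection from the tangent plane at \<open>p\<close> to the boundary divides by \<open>enorm\<close>. By
  \<open>enorm_tangent\<close> the Lipschitz constant of \<open>enorm\<close> on the part of the plane within distance \<open>\<rho>\<close> of
  \<open>p\<close> is of order \<open>\<rho>\<close>, so this division is a small perturbation of the identity.
\<close>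
lemma radial_almost_isometry:
  assumes p: "p \<in> surf" and \<eta>: "0 < \<eta>"
  obtains \<rho> where "0 < \<rho>"
    "\<And>x. normal p \<bullet> x = 1 \<Longrightarrow> dist x p < \<rho> \<Longrightarrow> 1 \<le> enorm x \<and> enorm x \<le> 1 + \<eta>"
    "\<And>x y. normal p \<bullet> x = 1 \<Longrightarrow> normal p \<bullet> y = 1 \<Longrightarrow> dist x p < \<rho> \<Longrightarrow> dist y p < \<rho> \<Longrightarrow>
       dist (radial x) (radial y) \<le> (1 + \<eta>) * dist x y \<and>
       dist x y \<le> (1 + \<eta>) * dist (radial x) (radial y)"
proof -
  obtain K where K: "0 < K" "\<And>x. norm (Q x) \<le> norm x * K"
    using linear_bounded_pos[OF linear_Q] by (metis mult.commute)
  have gK: "enorm x \<le> K * norm x" for x using K(2)[of x] by (simp add: enorm_def mult.commute)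
  define a where "a \<rho> = K\<^sup>2 * \<rho> * (norm p + \<rho>)" for \<rho>
  have "((\<lambda>\<rho>. K * \<rho>) \<longlongrightarrow> K * 0) (at_right 0)" by (intro tendsto_intros)
  then have e1: "\<forall>\<^sub>F \<rho> in at_right 0. K * \<rho> < \<eta>" using \<eta> by (intro order_tendstoD) auto
  have ta: "(a \<longlongrightarrow> K\<^sup>2 * 0 * (norm p + 0)) (at_right 0)"
    unfolding a_def[abs_def] by (intro tendsto_intros)
  then have e2: "\<forall>\<^sub>F \<rho> in at_right 0. a \<rho> < \<eta>" using \<eta> by (intro order_tendstoD) auto
  have "((\<lambda>\<rho>. (1 + \<eta>) * (1 / (1 + K * \<rho>) - a \<rho>)) \<longlongrightarrow>
      (1 + \<eta>) * (1 / (1 + K * 0) - K\<^sup>2 * 0 * (norm p + 0))) (at_right 0)"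
    by (intro tendsto_intros ta) auto
  then have e3: "\<forall>\<^sub>F \<rho> in at_right 0. 1 < (1 + \<eta>) * (1 / (1 + K * \<rho>) - a \<rho>)"
    using \<eta> by (intro order_tendstoD) auto
  have "\<forall>\<^sub>F \<rho> in at_right 0. 0 < \<rho> \<and> K * \<rho> < \<eta> \<and> a \<rho> < \<eta> \<and> 1 < (1 + \<eta>) * (1 / (1 + K * \<rho>) - a \<rho>)"
    using e1 e2 e3 eventually_at_right_less[of "0::real"] by eventually_elim blast
  from eventually_happens'[OF trivial_limit_at_right_real this]
  obtain \<rho> where \<rho>: "0 < \<rho>" "K * \<rho> < \<eta>" "a \<rho> < \<eta>" "1 < (1 + \<eta>) * (1 / (1 + K * \<rho>) - a \<rho>)"
    by auto
  show ?thesis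
  proof
    show "0 < \<rho>" by fact
    have g1: "1 \<le> enorm x" if "normal p \<bullet> x = 1" for x
    proof -
      have "1\<^sup>2 \<le> (enorm x)\<^sup>2" using enorm_tangent[OF p that] by simp
      then show ?thesis by (rule power2_le_imp_le) simp
    qed
    have gd: "enorm (x - p) \<le> K * \<rho>" if "dist x p < \<rho>" for x
    proof -
      have "K * norm (x - p) \<le> K * \<rho>" using that K(1) by (simp add: dist_norm)
      then show ?thesis using gK[of "x - p"] by linarith
    qed
    have g2: "enorm x \<le> 1 + K * \<rho>" if "dist x p < \<rho>" for x
      using enorm_triangle[of p "x - p"] gd[OF that] p by (simp add: surf_def)
    show "1 \<le> enorm x \<and> enorm x \<le> 1 + \<eta>" if "normal p \<bullet> x = 1" "dist x p < \<rho>" for x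
      using g1[OF that(1)] g2[OF that(2)] \<rho>(2) by simp
    fix x y assume x: "normal p \<bullet> x = 1" "dist x p < \<rho>" and y: "normal p \<bullet> y = 1" "dist y p < \<rho>"
    define w where "w = dist x y"
    have w0: "0 \<le> w" by (simp add: w_def)
    have diff: "\<bar>enorm x - enorm y\<bar> \<le> K\<^sup>2 * \<rho> * w"
    proof -
      let ?u = "enorm (x - p)" and ?v = "enorm (y - p)"
      have "\<bar>enorm x - enorm y\<bar> * 2 \<le> \<bar>enorm x - enorm y\<bar> * (enorm x + enorm y)"
        using g1[OF x(1)] g1[OF y(1)] by (intro mult_left_mono) auto
      also have "\<dots> = \<bar>(enorm x)\<^sup>2 - (enorm y)\<^sup>2\<bar>"
        by (simp add: power2_eq_square square_diff_square_factored abs_mult mult.commute)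
      also have "\<dots> = \<bar>?u\<^sup>2 - ?v\<^sup>2\<bar>"
        using enorm_tangent[OF p x(1)] enorm_tangent[OF p y(1)] by simp
      also have "\<dots> = \<bar>?u - ?v\<bar> * (?u + ?v)"
        by (simp add: power2_eq_square square_diff_square_factored abs_mult mult.commute)
      also have "\<dots> \<le> (K * w) * (2 * (K * \<rho>))"
      proof (rule mult_mono)
        have "\<bar>?u - ?v\<bar> \<le> enorm (x - y)" using enorm_diff_le[of "x - p" "y - p"] by simp
        also have "\<dots> \<le> K * w" using gK[of "x - y"] by (simp add: w_def dist_norm)
        finally show "\<bar>?u - ?v\<bar> \<le> K * w" .
        show "?u + ?v \<le> 2 * (K * \<rho>)" using gd[OF x(2)] gd[OF y(2)] by simp
      qed (use w0 K(1) in auto)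
      finally show ?thesis by (simp add: power2_eq_square algebra_simps)
    qed
    have gx: "1 \<le> enorm x" "enorm x \<le> 1 + K * \<rho>" and gy: "1 \<le> enorm y"
      using g1 g2 x y by auto
    define R where "R = (1 / enorm x - 1 / enorm y) *\<^sub>R y"
    have R: "norm R \<le> a \<rho> * w"
    proof -
      have "1 / enorm x - 1 / enorm y = (enorm y - enorm x) / (enorm x * enorm y)"
        using gx gy by (simp add: field_simps)
      then have "\<bar>1 / enorm x - 1 / enorm y\<bar> = \<bar>enorm x - enorm y\<bar> / (enorm x * enorm y)"
        using gx gy by (simp add: abs_mult abs_minus_commute)
      also have "\<dots> \<le> \<bar>enorm x - enorm y\<bar> / 1"
        using gx gy mult_mono[of 1 "enorm x" 1 "enorm y"] by (intro divide_left_mono) auto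
      also have "\<dots> \<le> K\<^sup>2 * \<rho> * w" using diff by simp
      finally have "\<bar>1 / enorm x - 1 / enorm y\<bar> \<le> K\<^sup>2 * \<rho> * w" .
      moreover have "norm y \<le> norm p + \<rho>"
        using norm_triangle_ineq[of p "y - p"] y(2) by (simp add: dist_norm)
      ultimately have "norm R \<le> (K\<^sup>2 * \<rho> * w) * (norm p + \<rho>)"
        unfolding R_def norm_scaleR using \<rho>(1) w0 by (intro mult_mono) auto
      then show ?thesis by (simp add: a_def mult_ac)
    qed
    have eq: "radial x - radial y = (1 / enorm x) *\<^sub>R (x - y) + R"
      by (simp add: radial_def R_def algebra_simps divide_inverse)
    have n1: "norm ((1 / enorm x) *\<^sub>R (x - y)) = w / enorm x"
      using gx by (simp add: w_def dist_norm)
    have "dist (radial x) (radial y) \<le> w / enorm x + a \<rho> * w"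
      using norm_triangle_ineq[of "(1 / enorm x) *\<^sub>R (x - y)" R] R unfolding n1 eq dist_norm by linarith
    also have "w / enorm x \<le> w"
      using mult_left_mono[OF gx(1) w0] gx(1) by (simp add: divide_le_eq)
    also have "a \<rho> * w \<le> \<eta> * w" using \<rho>(3) w0 by (intro mult_right_mono) auto
    finally have up: "dist (radial x) (radial y) \<le> (1 + \<eta>) * w" by (simp add: algebra_simps)
    have "w / (1 + K * \<rho>) \<le> w / enorm x" using gx w0 by (intro divide_left_mono) auto
    also have "\<dots> \<le> dist (radial x) (radial y) + a \<rho> * w"
      using norm_diff_ineq[of "(1 / enorm x) *\<^sub>R (x - y)" R] R unfolding n1 eq dist_norm by linarith
    finally have "w * (1 / (1 + K * \<rho>) - a \<rho>) \<le> dist (radial x) (radial y)"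
      by (simp add: algebra_simps)
    then have "(1 + \<eta>) * (w * (1 / (1 + K * \<rho>) - a \<rho>)) \<le> (1 + \<eta>) * dist (radial x) (radial y)"
      using \<eta> by (intro mult_left_mono) auto
    moreover have "w * 1 \<le> w * ((1 + \<eta>) * (1 / (1 + K * \<rho>) - a \<rho>))"
      using \<rho>(4) w0 by (intro mult_left_mono) auto
    ultimately have "w \<le> (1 + \<eta>) * dist (radial x) (radial y)" by (simp add: mult_ac)
    with up show "dist (radial x) (radial y) \<le> (1 + \<eta>) * dist x y \<and>
       dist x y \<le> (1 + \<eta>) * dist (radial x) (radial y)"
      by (simp add: w_def)
  qed
qed

text \<open>
  Orthonormal coordinates \<open>(s, y)\<close> adapted to \<open>p\<close>: \<open>s\<close> is the signed distance from the
  plane through the origin that is parallel to the tangent plane at \<open>p\<close>, so the tangent plane is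
  \<open>s = 1 / norm (normal p)\<close>.
\<close>
lemma tangent_coordinates:
  assumes DIM: "DIM('a) = DIM('b::euclidean_space) + 1" and p: "p \<in> surf"
  obtains L :: "real \<times> 'b::euclidean_space \<Rightarrow> 'a" and y where
    "linear L" "\<And>v. norm (L v) = norm v" "L (1 / norm (normal p), y) = p"
    "\<And>s y. normal p \<bullet> L (s, y) = s * norm (normal p)"
proof -
  define g where "g = normal p"
  have g: "g \<noteq> 0" "g \<bullet> p = 1" using normal_nonzero[OF p] normal_inner_surf[OF p] by (auto simp: g_def)
  define \<nu> where "\<nu> = g /\<^sub>R norm g"
  have \<nu>: "norm \<nu> = 1" "g \<bullet> \<nu> = norm g"
    using g(1) by (simp_all add: \<nu>_def power2_norm_eq_inner[symmetric] power2_eq_square)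
  define H where "H = {x. g \<bullet> x = 0}"
  have "dim (UNIV :: 'b set) = dim H"
    using dim_hyperplane[OF g(1)] DIM by (simp add: H_def)
  from isometries_subspaces[OF subspace_UNIV subspace_hyperplane[of g, folded H_def] this]
  obtain f where f: "linear f" "f ` (UNIV :: 'b set) = H" "\<And>x. norm (f x) = norm x"
    by (metis UNIV_I)
  define L where "L v = fst v *\<^sub>R \<nu> + f (snd v)" for v
  have orth: "g \<bullet> f y = 0" for y using f(2) by (auto simp: H_def)
  have "p - (1 / norm g) *\<^sub>R \<nu> \<in> H"
    using g \<nu>(2) by (simp add: H_def inner_diff_right)
  then obtain y where y: "f y = p - (1 / norm g) *\<^sub>R \<nu>" using f(2) by (metis imageE)
  show ?thesis
  proof
    show "linear L" unfolding L_def[abs_def]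
      by (intro linearI) (simp_all add: linear_add[OF f(1)] linear_scale[OF f(1)] algebra_simps)
    show "norm (L v) = norm v" for v
    proof -
      have "orthogonal (fst v *\<^sub>R \<nu>) (f (snd v))"
        using orth by (simp add: orthogonal_def \<nu>_def)
      then have "(norm (L v))\<^sup>2 = (norm v)\<^sup>2"
        unfolding L_def norm_add_Pythagorean[OF \<open>orthogonal _ _\<close>] using f(3) \<nu>(1)
        by (simp add: norm_prod_def)
      then show ?thesis by simp
    qed
    show "L (1 / norm (normal p), y) = p" using y by (simp add: L_def g_def)
    show "normal p \<bullet> L (s, y) = s * norm (normal p)" for s y
      using orth \<nu>(2) by (simp add: L_def g_def inner_add_right)
  qed
qed

text \<open>
  Let \<open>X\<close> be the piece of the tangent plane that projects radially onto \<open>A\<close>. The area of \<open>X\<close> is almost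
  that of \<open>A\<close>, since the projection is almost an isometry; the cones over \<open>X\<close> and \<open>A\<close> have almost the
  same volume, since \<open>enorm\<close> is almost 1 on \<open>X\<close>; and for \<open>X\<close> the relation between area and cone is the
  volume formula for a pyramid.
\<close>
lemma surface_piece_vs_cone:
  assumes DIM: "DIM('a) = DIM('b::euclidean_space) + 1" and p: "p \<in> surf" and e: "0 < e"
  obtains r where "0 < r"
    "\<And>A. A \<in> sets borel \<Longrightarrow> A \<subseteq> surf \<inter> ball p r \<Longrightarrow>
      hausdorff_outer_measure DIM('b) A
        \<le> ennreal ((1 + e) * (DIM('a) * norm (normal p))) * emeasure lborel (solid_cone A) \<and>
      ennreal (DIM('a) * norm (normal p)) * emeasure lborel (solid_cone A)
        \<le> ennreal (1 + e) * hausdorff_outer_measure DIM('b) A"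
proof -
  let ?k = "DIM('b)" and ?n = "DIM('a)"
  define g where "g = normal p"
  have g: "g \<noteq> 0" "g \<bullet> p = 1" using normal_nonzero[OF p] normal_inner_surf[OF p] by (auto simp: g_def)
  define h where "h = 1 / norm g"
  have h: "0 < h" using g by (simp add: h_def)
  define c where "c = ?n * norm g"
  have c: "0 < c" using g by (simp add: c_def)
  have "((\<lambda>\<eta>. (1 + \<eta>) ^ (?k + ?n)) \<longlongrightarrow> (1 + 0) ^ (?k + ?n)) (at_right (0::real))"
    by (intro tendsto_intros)
  then have "\<forall>\<^sub>F \<eta> in at_right (0::real). (1 + \<eta>) ^ (?k + ?n) < 1 + e"
    using e by (intro order_tendstoD) auto
  then have "\<forall>\<^sub>F \<eta> in at_right (0::real). 0 < \<eta> \<and> (1 + \<eta>) ^ (?k + ?n) < 1 + e"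
    using eventually_at_right_less[of "0::real"] by eventually_elim blast
  from eventually_happens'[OF trivial_limit_at_right_real this]
  obtain \<eta> :: real where \<eta>: "0 < \<eta>" "(1 + \<eta>) ^ (?k + ?n) < 1 + e" by auto
  have \<eta>k: "(1 + \<eta>) ^ ?k \<le> 1 + e"
    using \<eta> power_increasing[OF le_add1, of "1 + \<eta>" ?k ?n] by linarith
  obtain \<rho> where \<rho>: "0 < \<rho>"
    "\<And>x. g \<bullet> x = 1 \<Longrightarrow> dist x p < \<rho> \<Longrightarrow> 1 \<le> enorm x \<and> enorm x \<le> 1 + \<eta>"
    "\<And>x y. g \<bullet> x = 1 \<Longrightarrow> g \<bullet> y = 1 \<Longrightarrow> dist x p < \<rho> \<Longrightarrow> dist y p < \<rho> \<Longrightarrow>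
       dist (radial x) (radial y) \<le> (1 + \<eta>) * dist x y \<and>
       dist x y \<le> (1 + \<eta>) * dist (radial x) (radial y)"
    using radial_almost_isometry[OF p \<eta>(1)] unfolding g_def by metis
  \<comment> \<open>The inverse of \<open>radial\<close>: it moves boundary points near \<open>p\<close> back to the tangent plane.\<close>
  define \<tau> where "\<tau> a = a /\<^sub>R (g \<bullet> a)" for a
  have "isCont (\<lambda>a. g \<bullet> a) p" "isCont \<tau> p"
    unfolding \<tau>_def[abs_def] using g by (auto intro!: continuous_intros)
  then have "((\<lambda>a. g \<bullet> a) \<longlongrightarrow> 1) (at p)" "(\<tau> \<longlongrightarrow> p) (at p)"
    using g by (simp_all add: isCont_def \<tau>_def)
  then have "\<forall>\<^sub>F a in at p. 0 < g \<bullet> a \<and> dist (\<tau> a) p < \<rho>"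
    using \<rho>(1) by (intro eventually_conj) (auto intro: order_tendstoD tendstoD)
  then obtain r where r: "0 < r" "\<And>a. a \<noteq> p \<Longrightarrow> dist a p < r \<Longrightarrow> 0 < g \<bullet> a \<and> dist (\<tau> a) p < \<rho>"
    unfolding eventually_at by auto
  have r': "0 < g \<bullet> a" "dist (\<tau> a) p < \<rho>" if "a \<in> ball p r" for a
    using r(2)[of a] that g \<rho>(1) by (cases "a = p"; simp add: dist_commute \<tau>_def)+
  obtain L :: "real \<times> 'b \<Rightarrow> 'a" and y0 where L: "linear L" "\<And>v. norm (L v) = norm v" "L (h, y0) = p"
    "\<And>s y. g \<bullet> L (s, y) = s * norm g"
    using tangent_coordinates[OF DIM p, folded g_def h_def] by metis
  have DIM': "DIM(real \<times> 'b) = DIM('a)" using DIM by simp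
  have surjL: "surj L" by (rule linear_isometry_surj[OF DIM' L(1,2)])
  have dL: "dist (L u) (L v) = dist u v" for u v
    using L(2)[of "u - v"] L(1) by (simp add: dist_norm linear_diff)
  show ?thesis
  proof (rule that[OF r(1)], fold g_def, fold c_def)
    fix A assume A: "A \<in> sets borel" "A \<subseteq> surf \<inter> ball p r"
    define X where "X = \<tau> ` A"
    have tan: "g \<bullet> x = 1 \<and> dist x p < \<rho>" if "x \<in> X" for x
      using that A(2) r' by (fastforce simp: X_def \<tau>_def)
    have rad\<tau>: "radial (\<tau> a) = a" if "a \<in> A" for a
    proof -
      have "a \<in> surf" "a \<in> ball p r" using that A(2) by auto
      then show ?thesis
        using r'(1)[of a] radial_scale[of "inverse (g \<bullet> a)" a] radial_surf[of a] by (simp add: \<tau>_def)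
    qed
    have A_eq: "A = radial ` X" using rad\<tau> by (force simp: X_def)
    have X_eq: "x \<in> X \<longleftrightarrow> radial x \<in> A" if x: "g \<bullet> x = 1" for x
    proof
      assume "radial x \<in> A"
      moreover have "\<tau> (radial x) = x"
      proof -
        have "x \<noteq> 0" using x by auto
        then show ?thesis using x enorm_pos[of x] by (simp add: \<tau>_def radial_def)
      qed
      ultimately show "x \<in> X" by (force simp: X_def)
    qed (use rad\<tau> in \<open>auto simp: X_def\<close>)
    \<comment> \<open>The set \<open>X\<close> in the coordinates of the tangent plane.\<close>
    define Y where "Y = {y. radial (L (h, y)) \<in> A}"
    have gL: "g \<bullet> L (h, y) = 1" for y using L(4) g by (simp add: h_def)
    have XY: "X = (\<lambda>y. L (h, y)) ` Y"
    proof (intro equalityI subsetI)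
      fix x assume x: "x \<in> X"
      obtain s y where xs: "x = L (s, y)" using surjL by (metis surjD surj_pair)
      then have "s = h" using tan[OF x] L(4)[of s y] g by (simp add: h_def field_simps)
      then show "x \<in> (\<lambda>y. L (h, y)) ` Y" using x xs X_eq[of x] tan[OF x] by (auto simp: Y_def)
    next
      fix x assume "x \<in> (\<lambda>y. L (h, y)) ` Y"
      then show "x \<in> X" using X_eq gL by (auto simp: Y_def)
    qed
    have Y: "Y \<in> sets borel"
    proof -
      have "continuous_on UNIV L"
        by (rule linear_continuous_on) (simp add: linear_conv_bounded_linear[symmetric] L(1))
      then have "continuous_on UNIV (\<lambda>y. L (h, y))"
        by (rule continuous_on_compose2) (auto intro!: continuous_intros)
      then have "(\<lambda>y. L (h, y)) \<in> borel_measurable borel" by (rule borel_measurable_continuous_onI)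
      then have "(\<lambda>y. radial (L (h, y))) \<in> borel_measurable borel"
        using measurable_compose[OF _ measurable_radial] by blast
      from measurable_sets[OF this A(1)] show ?thesis by (simp add: Y_def vimage_def)
    qed
    have HX: "hausdorff_outer_measure ?k X = emeasure lborel Y"
      unfolding XY using hausdorff_outer_measure_eq_lborel[OF Y] dL
      by (subst hausdorff_outer_measure_isometry) (auto simp: dist_Pair_Pair)
    have up: "hausdorff_outer_measure ?k A \<le> ennreal ((1 + \<eta>) ^ ?k) * emeasure lborel Y"
      unfolding HX[symmetric] A_eq using \<eta>(1) \<rho>(3) tan
      by (intro hausdorff_outer_measure_Lipschitz_image) auto
    have lo: "emeasure lborel Y \<le> ennreal ((1 + \<eta>) ^ ?k) * hausdorff_outer_measure ?k A"
      unfolding HX[symmetric] X_def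
    proof (rule hausdorff_outer_measure_Lipschitz_image)
      fix a b assume ab: "a \<in> A" "b \<in> A"
      then have "\<tau> a \<in> X" "\<tau> b \<in> X" by (auto simp: X_def)
      then show "dist (\<tau> a) (\<tau> b) \<le> (1 + \<eta>) * dist a b"
        using \<rho>(3)[of "\<tau> a" "\<tau> b"] tan rad\<tau> ab by auto
    qed (use \<eta> in auto)
    have "X = L ` ({h} \<times> Y)" unfolding XY by auto
    then have coneX: "solid_cone X = L ` solid_cone ({h} \<times> Y)"
      using solid_cone_linear_image[OF L(1)] by simp
    note isoL = emeasure_lborel_linear_isometry[OF DIM' L(1,2) sets_solid_cone_flat[OF h Y]]
    have sX: "solid_cone X \<in> sets borel" unfolding coneX by (rule isoL(1))
    \<comment> \<open>The cone over \<open>X\<close> is a pyramid with base \<open>Y\<close> and height \<open>h\<close>, and \<open>c = (?k + 1) / h\<close>.\<close>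
    have "c * (h / (?k + 1)) = 1" using g DIM by (simp add: c_def h_def)
    then have VX: "ennreal c * emeasure lborel (solid_cone X) = emeasure lborel Y"
      unfolding coneX isoL(2) emeasure_solid_cone_flat[OF h Y] using c h
      by (simp add: mult.assoc[symmetric] ennreal_mult'[symmetric])
    have AS: "A \<subseteq> surf" using A(2) by auto
    have sA: "solid_cone A \<in> sets borel" by (rule sets_solid_cone_surf[OF AS A(1)])
    have "solid_cone A \<subseteq> solid_cone X"
    proof
      fix z assume "z \<in> solid_cone A"
      then obtain t x where z: "z = t *\<^sub>R radial x" "0 < t" "t \<le> 1" "x \<in> X"
        unfolding A_eq solid_cone_def by blast
      have nx: "1 \<le> enorm x" using tan[OF z(4)] \<rho>(2) by auto
      have "z = (t / enorm x) *\<^sub>R x" by (simp add: z(1) radial_def divide_inverse)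
      moreover have "0 < t / enorm x" "t / enorm x \<le> 1" using nx z by (auto simp: divide_le_eq)
      ultimately show "z \<in> solid_cone X" using z(4) unfolding solid_cone_def by blast
    qed
    then have VA1: "emeasure lborel (solid_cone A) \<le> emeasure lborel (solid_cone X)"
      using sX by (intro emeasure_mono) auto
    have "solid_cone X \<subseteq> {z. (1 / (1 + \<eta>)) *\<^sub>R z \<in> solid_cone A}"
    proof
      fix z assume "z \<in> solid_cone X"
      then obtain t x where z: "z = t *\<^sub>R x" "0 < t" "t \<le> 1" "x \<in> X"
        unfolding solid_cone_def by blast
      have nx: "1 \<le> enorm x" "enorm x \<le> 1 + \<eta>" using tan[OF z(4)] \<rho>(2) by auto
      have "(1 / (1 + \<eta>)) *\<^sub>R z = (t * enorm x / (1 + \<eta>)) *\<^sub>R radial x"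
        using nx by (simp add: z(1) radial_def)
      moreover have "0 < t * enorm x / (1 + \<eta>)" using nx z \<eta> by simp
      moreover have "t * enorm x / (1 + \<eta>) \<le> 1"
        using nx z \<eta> mult_mono[of t 1 "enorm x" "1 + \<eta>"] by (simp add: divide_le_eq)
      moreover have "radial x \<in> A" using z(4) unfolding A_eq by blast
      ultimately show "z \<in> {z. (1 / (1 + \<eta>)) *\<^sub>R z \<in> solid_cone A}"
        unfolding solid_cone_def by blast
    qed
    moreover have s1: "{z. (1 / (1 + \<eta>)) *\<^sub>R z \<in> solid_cone A} \<in> sets borel"
    proof -
      have "(\<lambda>z :: 'a. (1 / (1 + \<eta>)) *\<^sub>R z) \<in> borel_measurable borel" by measurable
      from measurable_sets[OF this sA] show ?thesis by (simp add: vimage_def)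
    qed
    ultimately have "emeasure lborel (solid_cone X)
        \<le> emeasure lborel {z. (1 / (1 + \<eta>)) *\<^sub>R z \<in> solid_cone A}"
      by (intro emeasure_mono) auto
    also have "\<dots> = ennreal ((1 + \<eta>) ^ ?n) * emeasure lborel (solid_cone A)"
    proof -
      have "emeasure lborel (solid_cone A) = ennreal ((1 / (1 + \<eta>)) ^ ?n) *
          emeasure lborel {z. (1 / (1 + \<eta>)) *\<^sub>R z \<in> solid_cone A}"
        using \<eta> by (intro emeasure_lborel_scale_vimage sA) auto
      moreover have "(1 + \<eta>) ^ ?n * (1 / (1 + \<eta>)) ^ ?n = 1"
        using \<eta> by (simp add: power_mult_distrib[symmetric])
      ultimately show ?thesis using \<eta>
        by (simp add: mult.assoc[symmetric] ennreal_mult'[symmetric])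
    qed
    finally have VA2: "emeasure lborel (solid_cone X) \<le> ennreal ((1 + \<eta>) ^ ?n) * emeasure lborel (solid_cone A)" .
    have "hausdorff_outer_measure ?k A \<le> ennreal ((1 + \<eta>) ^ ?k) * (ennreal c * emeasure lborel (solid_cone X))"
      using up by (simp add: VX)
    also have "\<dots> \<le> ennreal ((1 + \<eta>) ^ ?k) * (ennreal c * (ennreal ((1 + \<eta>) ^ ?n) * emeasure lborel (solid_cone A)))"
      by (intro mult_left_mono VA2) auto
    also have "\<dots> = ennreal ((1 + \<eta>) ^ (?k + ?n) * c) * emeasure lborel (solid_cone A)"
      using \<eta> c by (simp add: ennreal_mult power_add mult_ac)
    also have "\<dots> \<le> ennreal ((1 + e) * c) * emeasure lborel (solid_cone A)"
      using \<eta> c by (intro mult_right_mono ennreal_leI) auto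
    finally have 1: "hausdorff_outer_measure ?k A \<le> ennreal ((1 + e) * c) * emeasure lborel (solid_cone A)" .
    have "ennreal c * emeasure lborel (solid_cone A) \<le> emeasure lborel Y"
      unfolding VX[symmetric] by (intro mult_left_mono VA1) auto
    also have "\<dots> \<le> ennreal ((1 + \<eta>) ^ ?k) * hausdorff_outer_measure ?k A" by (rule lo)
    also have "\<dots> \<le> ennreal (1 + e) * hausdorff_outer_measure ?k A"
      using \<eta>k by (intro mult_right_mono ennreal_leI) auto
    finally show "hausdorff_outer_measure ?k A \<le> ennreal ((1 + e) * c) * emeasure lborel (solid_cone A) \<and>
      ennreal c * emeasure lborel (solid_cone A) \<le> ennreal (1 + e) * hausdorff_outer_measure ?k A"
      using 1 by blast
  qed
qed

section \<open>The boundary area of an ellipsoid as an integral over its interior\<close>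

lemma compact_surf: "compact surf"
proof -
  have "inj Q" unfolding linear_injective_0[OF linear_Q] using Q_eq_0 by blast
  then obtain B where B: "0 < B" "\<And>x. B * norm x \<le> norm (Q x)"
    using linear_inj_bounded_below_pos[OF linear_Q] by metis
  have "norm x \<le> 1 / B" if "x \<in> surf" for x
    using B(2)[of x] B(1) that by (simp add: surf_def enorm_def field_simps)
  then have "bounded surf" unfolding bounded_iff by blast
  moreover have "closed surf"
    unfolding surf_def by (intro closed_Collect_eq continuous_on_enorm continuous_on_const)
  ultimately show ?thesis by (simp add: compact_eq_bounded_closed)
qed

lemma sets_surf: "surf \<in> sets borel"
  using compact_surf by (simp add: borel_compact)

lemma frontier_ellipsoid: "frontier {x. enorm x \<le> 1} = surf"
proof -
  have cl: "closed {x. enorm x \<le> 1}"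
    by (intro closed_Collect_le continuous_on_enorm continuous_on_const)
  have int: "interior {x. enorm x \<le> 1} = {x. enorm x < 1}"
  proof (rule interior_unique)
    show "open {x. enorm x < 1}"
      by (intro open_Collect_less continuous_on_enorm continuous_on_const)
    fix T assume T: "T \<subseteq> {x. enorm x \<le> 1}" "open T"
    show "T \<subseteq> {x. enorm x < 1}"
    proof (rule ccontr)
      assume "\<not> ?thesis"
      then obtain x where x: "x \<in> T" "enorm x = 1" using T(1) by force
      have x0: "x \<noteq> 0" using x(2) by auto
      obtain d where d: "0 < d" "ball x d \<subseteq> T" using T(2) x(1) openE by blast
      define s where "s = d / (2 * norm x)"
      have s: "0 < s" using d x0 by (simp add: s_def)
      have "dist x ((1 + s) *\<^sub>R x) = s * norm x"
        using s by (simp add: dist_norm algebra_simps)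
      also have "\<dots> < d" using d x0 by (simp add: s_def)
      finally have "(1 + s) *\<^sub>R x \<in> T" using d(2) by auto
      then have "enorm ((1 + s) *\<^sub>R x) \<le> 1" using T(1) by auto
      then show False using s x(2) by (simp add: enorm_scale)
    qed
  qed auto
  show ?thesis
    unfolding frontier_def closure_closed[OF cl] int by (auto simp: surf_def)
qed

text \<open>
  The value of \<open>DIM('a) * norm (normal a)\<close> at the boundary point \<open>a = radial x\<close>, see
  \<open>density_factor_radial\<close>; it is 0 at the origin, where \<open>radial x\<close> is 0 too.
\<close>
definition density_factor :: "'a \<Rightarrow> real" where
  "density_factor x = DIM('a) * (norm (normal x) / enorm x)"

text \<open>
  The cone measure of the ellipsoid (the image of Lebesgue measure on the ellipsoid under radial
  projection), weighted with \<open>DIM('a) * norm (normal a)\<close>.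
\<close>
definition surface_measure :: "'a measure" where
  "surface_measure = distr (density lborel
     (\<lambda>x. ennreal (density_factor x) * indicator {x. enorm x \<le> 1} x)) borel radial"

lemma sets_surface_measure [simp, measurable_cong]: "sets surface_measure = sets borel"
  by (simp add: surface_measure_def)

lemma space_surface_measure [simp]: "space surface_measure = UNIV"
  by (simp add: surface_measure_def)

lemma measurable_density_factor [measurable]: "density_factor \<in> borel_measurable borel"
  unfolding density_factor_def[abs_def] by measurable

lemma nn_integral_surface_measure:
  assumes [measurable]: "f \<in> borel_measurable borel"
  shows "(\<integral>\<^sup>+ u. f u \<partial>surface_measure) =
    (\<integral>\<^sup>+ x. ennreal (density_factor x) * indicator {x. enorm x \<le> 1} x * f (radial x) \<partial>lborel)"
  unfolding surface_measure_def
  by (subst nn_integral_distr; (subst nn_integral_density)?) auto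

lemma emeasure_surface_measure:
  assumes A: "A \<in> sets borel" "A \<subseteq> surf"
  shows "emeasure surface_measure A =
    (\<integral>\<^sup>+ x. ennreal (density_factor x) * indicator (solid_cone A) x \<partial>lborel)"
proof -
  have "emeasure surface_measure A = (\<integral>\<^sup>+ u. indicator A u \<partial>surface_measure)"
    using A by simp
  also have "\<dots> = (\<integral>\<^sup>+ x. ennreal (density_factor x) * indicator {x. enorm x \<le> 1} x * indicator A (radial x) \<partial>lborel)"
    using A by (intro nn_integral_surface_measure) simp
  also have "\<dots> = (\<integral>\<^sup>+ x. ennreal (density_factor x) * indicator (solid_cone A) x \<partial>lborel)"
    unfolding solid_cone_surf[OF A(2)] by (intro nn_integral_cong) (auto simp: indicator_def)
  finally show ?thesis .
qed

lemma density_factor_radial: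
  "x \<noteq> 0 \<Longrightarrow> density_factor x = DIM('a) * norm (normal (radial x))"
  using enorm_pos[of x] by (simp add: density_factor_def radial_def linear_scale[OF linear_normal] divide_inverse_commute)

text \<open>
  The same estimate as in \<open>surface_piece_vs_cone\<close>, here simply because \<open>normal\<close> is continuous.
\<close>
lemma surface_measure_piece_vs_cone:
  assumes p: "p \<in> surf" and e: "0 < e"
  obtains r where "0 < r"
    "\<And>A. A \<in> sets borel \<Longrightarrow> A \<subseteq> surf \<inter> ball p r \<Longrightarrow>
      emeasure surface_measure A
        \<le> ennreal ((1 + e) * (DIM('a) * norm (normal p))) * emeasure lborel (solid_cone A) \<and>
      ennreal (DIM('a) * norm (normal p)) * emeasure lborel (solid_cone A)
        \<le> ennreal (1 + e) * emeasure surface_measure A"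
proof -
  let ?g = "norm (normal p)"
  have g: "0 < ?g" using normal_nonzero[OF p] by simp
  have "isCont normal p" using continuous_on_normal[of UNIV] by (simp add: continuous_on_eq_continuous_at)
  then have t: "((\<lambda>a. norm (normal a)) \<longlongrightarrow> ?g) (at p)"
    unfolding isCont_def by (rule tendsto_norm)
  then have t': "((\<lambda>a. (1 + e) * norm (normal a)) \<longlongrightarrow> (1 + e) * ?g) (at p)"
    by (rule tendsto_mult[OF tendsto_const])
  have gg: "?g < (1 + e) * ?g" using g e by simp
  have "\<forall>\<^sub>F a in at p. norm (normal a) < (1 + e) * ?g \<and> ?g < (1 + e) * norm (normal a)"
    using order_tendstoD(2)[OF t gg] order_tendstoD(1)[OF t' gg] by eventually_elim blast
  then obtain r where r: "0 < r"
    "\<And>a. a \<noteq> p \<Longrightarrow> dist a p < r \<Longrightarrow> norm (normal a) < (1 + e) * ?g \<and> ?g < (1 + e) * norm (normal a)"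
    unfolding eventually_at by auto
  have r': "norm (normal a) \<le> (1 + e) * ?g" "?g \<le> (1 + e) * norm (normal a)" if "a \<in> ball p r" for a
    using r(2)[of a] that gg by (cases "a = p"; force simp: dist_commute)+
  show ?thesis
  proof (rule that[OF r(1)])
    fix A assume A: "A \<in> sets borel" "A \<subseteq> surf \<inter> ball p r"
    have AS: "A \<subseteq> surf" using A by auto
    have sA [measurable]: "solid_cone A \<in> sets borel" by (rule sets_solid_cone_surf[OF AS A(1)])
    have fac: "density_factor x \<le> (1 + e) * (DIM('a) * ?g)" "DIM('a) * ?g \<le> (1 + e) * density_factor x"
      if x: "x \<in> solid_cone A" for x
    proof -
      have "radial x \<in> A" using x solid_cone_surf[OF AS] by auto
      then have "x \<noteq> 0" "radial x \<in> ball p r"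
        using A(2) surf_nonzero[of 0] by (auto simp: radial_def)
      then show "density_factor x \<le> (1 + e) * (DIM('a) * ?g)" "DIM('a) * ?g \<le> (1 + e) * density_factor x"
        using r'[of "radial x"] by (auto simp: density_factor_radial mult.left_commute intro!: mult_left_mono)
    qed
    have "emeasure surface_measure A \<le> (\<integral>\<^sup>+ x. ennreal ((1 + e) * (DIM('a) * ?g)) * indicator (solid_cone A) x \<partial>lborel)"
      unfolding emeasure_surface_measure[OF A(1) AS]
      by (intro nn_integral_mono) (auto simp: indicator_def intro!: ennreal_leI fac)
    also have "\<dots> = ennreal ((1 + e) * (DIM('a) * ?g)) * emeasure lborel (solid_cone A)"
      by (intro nn_integral_cmult_indicator) simp
    finally have 1: "emeasure surface_measure A \<le> \<dots>" .
    have "ennreal (DIM('a) * ?g) * emeasure lborel (solid_cone A) =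
        (\<integral>\<^sup>+ x. ennreal (DIM('a) * ?g) * indicator (solid_cone A) x \<partial>lborel)"
      by (intro nn_integral_cmult_indicator[symmetric]) simp
    also have "\<dots> \<le> (\<integral>\<^sup>+ x. ennreal (1 + e) * (ennreal (density_factor x) * indicator (solid_cone A) x) \<partial>lborel)"
    proof (rule nn_integral_mono)
      fix x
      show "ennreal (DIM('a) * ?g) * indicator (solid_cone A) x
          \<le> ennreal (1 + e) * (ennreal (density_factor x) * indicator (solid_cone A) x)"
      proof (cases "x \<in> solid_cone A")
        case True
        then show ?thesis using ennreal_leI[OF fac(2)[OF True]] e by (simp add: ennreal_mult')
      qed simp
    qed
    also have "\<dots> = ennreal (1 + e) * emeasure surface_measure A"
      unfolding emeasure_surface_measure[OF A(1) AS] by (intro nn_integral_cmult) measurable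
    finally show "emeasure surface_measure A \<le> ennreal ((1 + e) * (DIM('a) * ?g)) * emeasure lborel (solid_cone A) \<and>
        ennreal (DIM('a) * ?g) * emeasure lborel (solid_cone A) \<le> ennreal (1 + e) * emeasure surface_measure A"
      using 1 by blast
  qed
qed

text \<open>
  Near each point both measures agree with the same multiple of the cone volume up to a factor
  \<open>1 + e\<close>, hence with each other up to \<open>(1 + e)\<^sup>2\<close>.
\<close>
theorem hausdorff_measure_surf:
  assumes DIM: "DIM('a) = DIM('b::euclidean_space) + 1" and A: "A \<in> sets borel" "A \<subseteq> surf"
  shows "emeasure (hausdorff_measure DIM('b)) A = emeasure surface_measure A"
proof -
  let ?H = "hausdorff_measure DIM('b) :: 'a measure"
  have loc: "\<exists>r>0. \<forall>A\<in>sets borel. A \<subseteq> surf \<inter> ball p r \<longrightarrow>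
      emeasure ?H A \<le> ennreal ((1 + e)\<^sup>2) * emeasure surface_measure A \<and>
      emeasure surface_measure A \<le> ennreal ((1 + e)\<^sup>2) * emeasure ?H A"
    if p: "p \<in> surf" and e: "0 < e" for p and e :: real
  proof -
    define c where "c = DIM('a) * norm (normal p)"
    have c: "0 \<le> c" by (simp add: c_def)
    have sq: "ennreal ((1 + e)\<^sup>2) = ennreal (1 + e) * ennreal (1 + e)"
      using e by (simp add: power2_eq_square ennreal_mult)
    have ec: "ennreal ((1 + e) * c) = ennreal (1 + e) * ennreal c"
      using e c by (simp add: ennreal_mult)
    obtain r1 where r1: "0 < r1" "\<And>A. A \<in> sets borel \<Longrightarrow> A \<subseteq> surf \<inter> ball p r1 \<Longrightarrow>
      hausdorff_outer_measure DIM('b) A \<le> ennreal ((1 + e) * c) * emeasure lborel (solid_cone A) \<and>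
      ennreal c * emeasure lborel (solid_cone A) \<le> ennreal (1 + e) * hausdorff_outer_measure DIM('b) A"
      using surface_piece_vs_cone[OF DIM p e, folded c_def] by metis
    obtain r2 where r2: "0 < r2" "\<And>A. A \<in> sets borel \<Longrightarrow> A \<subseteq> surf \<inter> ball p r2 \<Longrightarrow>
      emeasure surface_measure A \<le> ennreal ((1 + e) * c) * emeasure lborel (solid_cone A) \<and>
      ennreal c * emeasure lborel (solid_cone A) \<le> ennreal (1 + e) * emeasure surface_measure A"
      using surface_measure_piece_vs_cone[OF p e, folded c_def] by metis
    show ?thesis
    proof (intro exI[of _ "min r1 r2"] conjI ballI impI)
      fix A assume A: "A \<in> sets borel" "A \<subseteq> surf \<inter> ball p (min r1 r2)"
      let ?V = "emeasure lborel (solid_cone A)"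
      have "A \<subseteq> surf \<inter> ball p r1" "A \<subseteq> surf \<inter> ball p r2" using A(2) by auto
      note b = r1(2)[OF A(1) this(1)] r2(2)[OF A(1) this(2)]
      note H = emeasure_hausdorff_measure[OF A(1), of "DIM('b)"]
      have "emeasure ?H A \<le> ennreal (1 + e) * (ennreal c * ?V)"
        using b(1) by (simp add: H ec mult.assoc)
      also have "\<dots> \<le> ennreal (1 + e) * (ennreal (1 + e) * emeasure surface_measure A)"
        using b(2) by (intro mult_left_mono) auto
      finally show "emeasure ?H A \<le> ennreal ((1 + e)\<^sup>2) * emeasure surface_measure A"
        by (simp add: sq mult.assoc)
      have "emeasure surface_measure A \<le> ennreal (1 + e) * (ennreal c * ?V)"
        using b(2) by (simp add: ec mult.assoc)
      also have "\<dots> \<le> ennreal (1 + e) * (ennreal (1 + e) * emeasure ?H A)"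
        using b(1) by (intro mult_left_mono) (auto simp: H)
      finally show "emeasure surface_measure A \<le> ennreal ((1 + e)\<^sup>2) * emeasure ?H A"
        by (simp add: sq mult.assoc)
    qed (use r1 r2 in auto)
  qed
  show ?thesis
  proof (rule antisym)
    show "emeasure ?H A \<le> emeasure surface_measure A"
    proof (rule ennreal_le_if_le_near_one, rule emeasure_le_if_locally[OF compact_surf _ _ _ A])
      fix e :: real and p assume "0 < e" "p \<in> surf"
      from loc[OF this(2,1)]
      show "\<exists>r>0. \<forall>A\<in>sets borel. A \<subseteq> surf \<inter> ball p r \<longrightarrow>
          emeasure ?H A \<le> ennreal ((1 + e)\<^sup>2) * emeasure surface_measure A" by meson
    qed simp_all
    show "emeasure surface_measure A \<le> emeasure ?H A"
    proof (rule ennreal_le_if_le_near_one, rule emeasure_le_if_locally[OF compact_surf _ _ _ A])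
      fix e :: real and p assume "0 < e" "p \<in> surf"
      from loc[OF this(2,1)]
      show "\<exists>r>0. \<forall>A\<in>sets borel. A \<subseteq> surf \<inter> ball p r \<longrightarrow>
          emeasure surface_measure A \<le> ennreal ((1 + e)\<^sup>2) * emeasure ?H A" by meson
    qed simp_all
  qed
qed

end

section \<open>The unit sphere, and Euclidean space of one dimension less\<close>

text \<open>
  One element is removed from the index type \<open>'n\<close>, so that \<open>real ^ 'n less1\<close> has one dimension less than
  \<open>real ^ 'n\<close> and can serve as tangent space. If \<open>'n\<close> has only one element, that element is kept,
  because types must be inhabited.
\<close>
typedef 'n less1 = "{x :: 'n. x = undefined \<longrightarrow> (\<forall>y. y = x)}"
  by (cases "\<exists>y :: 'n. y \<noteq> undefined") auto

instance less1 :: (finite) finite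
proof
  have eq: "(UNIV :: 'a less1 set) = Abs_less1 ` {x. x = undefined \<longrightarrow> (\<forall>y. y = x)}"
    by (rule type_definition.Abs_image[OF type_definition_less1, symmetric])
  show "finite (UNIV :: 'a less1 set)" unfolding eq by (intro finite_imageI finite)
qed

lemma card_less1:
  assumes "CARD('n::finite) \<ge> 2"
  shows "CARD('n less1) = CARD('n) - 1"
proof -
  have "\<exists>y :: 'n. y \<noteq> undefined"
  proof (rule ccontr)
    assume "\<not> ?thesis"
    then have "(UNIV :: 'n set) = {undefined}" by auto
    then have "CARD('n) = 1" by (metis card_1_singleton_iff One_nat_def)
    with assms show False by simp
  qed
  then have "{x :: 'n. x = undefined \<longrightarrow> (\<forall>y. y = x)} = UNIV - {undefined}" by auto
  then show ?thesis
    using type_definition.card[OF type_definition_less1, where 'a='n] by (simp add: card_Diff_singleton)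
qed

text \<open>
  The factor \<open>d\<close> is the absolute value of the determinant; it will cancel in the quotient of area and
  volume.
\<close>
lemma nn_integral_lborel_diagonal:
  fixes q :: "'n::finite \<Rightarrow> real"
  assumes q: "\<And>i. q i \<noteq> 0"
  obtains d where "0 < d" "\<And>G :: real ^ 'n \<Rightarrow> ennreal. G \<in> borel_measurable borel \<Longrightarrow>
      (\<integral>\<^sup>+ x. G x \<partial>lborel) = ennreal d * (\<integral>\<^sup>+ x. G (\<chi> i. q i * x $ i) \<partial>lborel)"
proof -
  define Q where "Q x = (\<chi> i. q i * x $ i)" for x :: "real ^ 'n"
  define c where "c b = Q b \<bullet> b" for b
  have c: "c (axis i 1) = q i" for i
    by (simp add: c_def Q_def inner_axis)
  have T: "(0 + (\<Sum>j\<in>Basis. (c j * (x \<bullet> j)) *\<^sub>R j)) = Q x" for x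
  proof (rule vec_eq_iff[THEN iffD2], rule allI)
    fix i
    have "(\<Sum>j\<in>Basis. (c j * (x \<bullet> j)) *\<^sub>R j) $ i = (\<Sum>j\<in>Basis. (c j * (x \<bullet> j)) *\<^sub>R j) \<bullet> axis i 1"
      by (simp add: inner_axis)
    also have "\<dots> = c (axis i 1) * (x \<bullet> axis i 1)"
      by (subst inner_sum_left_Basis) (auto simp: Basis_vec_def)
    also have "\<dots> = Q x $ i" by (simp add: c Q_def inner_axis)
    finally show "(0 + (\<Sum>j\<in>Basis. (c j * (x \<bullet> j)) *\<^sub>R j)) $ i = Q x $ i" by simp
  qed
  define d where "d = (\<Prod>j\<in>Basis. \<bar>c j\<bar>)"
  have c0: "c j \<noteq> 0" if "j \<in> Basis" for j using that q c by (auto simp: Basis_vec_def)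
  have d: "0 < d" unfolding d_def using c0 by (intro prod_pos) auto
  have lb: "lborel = density (distr lborel borel Q) (\<lambda>_. ennreal d)"
    using lborel_affine_euclidean[where c = c and t = 0] c0
    unfolding T d_def by simp
  have [measurable]: "Q \<in> borel_measurable borel"
    unfolding Q_def[abs_def] by (intro borel_measurable_continuous_onI continuous_intros)
  show ?thesis
  proof (rule that[OF d])
    fix G :: "real ^ 'n \<Rightarrow> ennreal" assume [measurable]: "G \<in> borel_measurable borel"
    have "(\<integral>\<^sup>+ x. G x \<partial>lborel) = (\<integral>\<^sup>+ x. G x \<partial>density (distr lborel borel Q) (\<lambda>_. ennreal d))"
      using lb by simp
    also have "\<dots> = (\<integral>\<^sup>+ x. ennreal d * G x \<partial>distr lborel borel Q)"
      by (rule nn_integral_density) measurable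
    also have "\<dots> = (\<integral>\<^sup>+ x. ennreal d * G (Q x) \<partial>lborel)"
      by (rule nn_integral_distr) measurable
    also have "\<dots> = ennreal d * (\<integral>\<^sup>+ x. G (Q x) \<partial>lborel)"
      by (rule nn_integral_cmult) measurable
    finally show "(\<integral>\<^sup>+ x. G x \<partial>lborel) = ennreal d * (\<integral>\<^sup>+ x. G (\<chi> i. q i * x $ i) \<partial>lborel)"
      by (simp add: Q_def)
  qed
qed

text \<open>
  For the unit ball the normal at \<open>u\<close> is \<open>u\<close> itself, so the density of the surface measure is the
  constant \<open>CARD('n)\<close>.
\<close>
lemma nn_integral_sphere_area:
  fixes f :: "real ^ 'n::finite \<Rightarrow> ennreal"
  assumes n: "CARD('n) \<ge> 2" and [measurable]: "f \<in> borel_measurable borel"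
  shows "(\<integral>\<^sup>+ u. f u \<partial>sphere_area) =
    ennreal CARD('n) * (\<integral>\<^sup>+ x. f (x /\<^sub>R norm x) * indicator (cball 0 1) x \<partial>lborel)"
proof -
  interpret B: ellipsoid "\<lambda>x :: real ^ 'n. x"
    by standard (auto simp: linear_iff)
  have DIM: "DIM(real ^ 'n) = DIM(real ^ 'n less1) + 1"
    using card_less1[OF n] n by simp
  have k: "DIM(real ^ 'n less1) = CARD('n) - 1" using card_less1[OF n] by simp
  have e: "B.enorm = norm" by (rule ext) (simp add: B.enorm_def)
  have S: "B.surf = sphere 0 1" by (auto simp: B.surf_def e)
  have rad: "B.radial x = x /\<^sub>R norm x" for x by (simp add: B.radial_def e)
  have nrm: "B.normal x = x" for x
    using adjoint_unique[of "\<lambda>x. x" "\<lambda>x :: real ^ 'n. x"] by (simp add: B.normal_def)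
  have fac: "B.density_factor x = (if x = 0 then 0 else CARD('n))" for x
    by (simp add: B.density_factor_def nrm e)
  have [measurable]: "sphere 0 1 \<in> sets (borel :: (real ^ 'n) measure)"
    "cball 0 1 \<in> sets (borel :: (real ^ 'n) measure)" by simp_all
  have area: "sphere_area = restrict_space B.surface_measure (sphere 0 1)"
  proof (rule measure_eqI)
    show "sets (sphere_area :: (real ^ 'n) measure) = sets (restrict_space B.surface_measure (sphere 0 1))"
      unfolding sphere_area_def by (intro sets_restrict_space_cong) simp
    fix A assume "A \<in> sets (sphere_area :: (real ^ 'n) measure)"
    then have A: "A \<in> sets borel" "A \<subseteq> sphere 0 1"
      by (auto simp: sphere_area_def sets_restrict_space_iff)
    have "emeasure (hausdorff_measure (CARD('n) - 1)) A = emeasure B.surface_measure A"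
      using B.hausdorff_measure_surf[OF DIM, of A] A k S by simp
    then show "emeasure sphere_area A = emeasure (restrict_space B.surface_measure (sphere 0 1)) A"
      unfolding sphere_area_def using A by (simp add: emeasure_restrict_space)
  qed
  have "(\<integral>\<^sup>+ u. f u \<partial>sphere_area) = (\<integral>\<^sup>+ u. f u * indicator (sphere 0 1) u \<partial>B.surface_measure)"
    unfolding area by (rule nn_integral_restrict_space) simp
  also have "\<dots> = (\<integral>\<^sup>+ x. ennreal (B.density_factor x) * indicator {x. B.enorm x \<le> 1} x *
      (f (B.radial x) * indicator (sphere 0 1) (B.radial x)) \<partial>lborel)"
    by (rule B.nn_integral_surface_measure) measurable
  also have "\<dots> = (\<integral>\<^sup>+ x. ennreal CARD('n) * (f (x /\<^sub>R norm x) * indicator (cball 0 1) x) \<partial>lborel)"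
  proof (rule nn_integral_cong_AE)
    have "AE x in lborel. x \<noteq> (0 :: real ^ 'n)" by (rule AE_lborel_singleton)
    then show "AE x in lborel. ennreal (B.density_factor x) * indicator {x. B.enorm x \<le> 1} x *
      (f (B.radial x) * indicator (sphere 0 1) (B.radial x)) =
      ennreal CARD('n) * (f (x /\<^sub>R norm x) * indicator (cball 0 1) x)"
      by eventually_elim (auto simp: fac e rad indicator_def)
  qed
  also have "\<dots> = ennreal CARD('n) * (\<integral>\<^sup>+ x. f (x /\<^sub>R norm x) * indicator (cball 0 1) x \<partial>lborel)"
    by (rule nn_integral_cmult) measurable
  finally show ?thesis .
qed

section \<open>The boundary area of an axis-parallel ellipsoid\<close>

theorem mainTheorem1:
  fixes q :: "'n::finite \<Rightarrow> real" and E :: "(real ^ 'n) set"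
  assumes "CARD('n) \<ge> 2"
    and "\<And>i. q i > 0"
    and "E = {x. (\<Sum>i\<in>UNIV. (q i)\<^sup>2 * (x $ i)\<^sup>2) \<le> 1}"
  shows "measure (hausdorff_measure (CARD('n) - 1)) (frontier E) / measure lborel E
    = real CARD('n) * sphere_average (\<lambda>u. sqrt (\<Sum>i\<in>UNIV. (u $ i)\<^sup>2 * (q i)\<^sup>2))"
proof -
  let ?n = "CARD('n)"
  define Q where "Q x = (\<chi> i. q i * x $ i)" for x :: "real ^ 'n"
  have normQ: "norm (Q x) = sqrt (\<Sum>i\<in>UNIV. (x $ i)\<^sup>2 * (q i)\<^sup>2)" for x
    by (simp add: Q_def norm_vec_def L2_set_def power_mult_distrib mult.commute)
  have linQ: "linear Q"
    by (rule linearI) (simp_all add: Q_def vec_eq_iff algebra_simps)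
  interpret E: ellipsoid Q
  proof (rule ellipsoid.intro)
    fix x assume "Q x = 0"
    then have "q i * x $ i = 0" for i by (simp add: Q_def vec_eq_iff)
    then show "x = 0" using assms(2) by (auto simp: vec_eq_iff) (metis less_irrefl)
  qed (rule linQ)
  have [measurable]: "Q \<in> borel_measurable borel"
    by (rule borel_measurable_continuous_onI[OF E.continuous_on_Q])
  have nrm: "E.normal x = Q (Q x)" for x
  proof -
    have "adjoint Q = Q"
      by (rule adjoint_unique) (simp add: Q_def inner_vec_def mult_ac)
    then show ?thesis by (simp add: E.normal_def)
  qed
  have DIM: "DIM(real ^ 'n) = DIM(real ^ 'n less1) + 1"
    using card_less1[OF assms(1)] assms(1) by simp
  have k: "DIM(real ^ 'n less1) = ?n - 1" using card_less1[OF assms(1)] by simp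
  have E: "E = {x. E.enorm x \<le> 1}"
    unfolding assms(3) by (simp add: E.enorm_def normQ mult.commute)
  have "q i \<noteq> 0" for i using assms(2)[of i] by simp
  from nn_integral_lborel_diagonal[of q, OF this, folded Q_def]
  obtain d where d: "0 < d" "\<And>G :: real ^ 'n \<Rightarrow> ennreal. G \<in> borel_measurable borel \<Longrightarrow>
      (\<integral>\<^sup>+ x. G x \<partial>lborel) = ennreal d * (\<integral>\<^sup>+ x. G (Q x) \<partial>lborel)"
    by blast
  define G where "G x = ennreal (norm (Q x) / norm x) * indicator (cball 0 1) x" for x
  have [measurable]: "cball 0 1 \<in> sets (borel :: (real ^ 'n) measure)" by simp
  have [measurable]: "G \<in> borel_measurable borel" unfolding G_def by measurable
  define X where "X = (\<integral>\<^sup>+ x. G x \<partial>lborel)"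
  define W where "W = emeasure lborel (cball (0 :: real ^ 'n) 1)"
  have W: "0 < enn2real W"
    by (simp add: W_def emeasure_cball)

  \<comment> \<open>The area of the boundary, after the substitution \<open>y = Q x\<close>.\<close>
  have "emeasure (hausdorff_measure (?n - 1)) (frontier E) = emeasure E.surface_measure E.surf"
    using E.hausdorff_measure_surf[OF DIM E.sets_surf] k unfolding E E.frontier_ellipsoid by simp
  also have "\<dots> = (\<integral>\<^sup>+ x. ennreal (E.density_factor x) * indicator (solid_cone E.surf) x \<partial>lborel)"
    by (rule E.emeasure_surface_measure[OF E.sets_surf order_refl])
  also have "\<dots> = (\<integral>\<^sup>+ x. ennreal ?n * G (Q x) \<partial>lborel)"
  proof (rule nn_integral_cong)
    fix x :: "real ^ 'n"
    show "ennreal (E.density_factor x) * indicator (solid_cone E.surf) x = ennreal ?n * G (Q x)"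
    proof (cases "x = 0")
      case True
      then show ?thesis by (simp add: E.density_factor_def G_def linear_0[OF linQ])
    next
      case False
      then have "x \<in> solid_cone E.surf \<longleftrightarrow> norm (Q x) \<le> 1"
        using E.enorm_radial[OF False] by (simp add: E.solid_cone_surf E.surf_def E.enorm_def)
      then show ?thesis
        by (simp add: E.density_factor_def G_def nrm E.enorm_def indicator_def ennreal_mult'[symmetric])
    qed
  qed
  also have "\<dots> = ennreal ?n * (\<integral>\<^sup>+ x. G (Q x) \<partial>lborel)" by (rule nn_integral_cmult) measurable
  finally have "ennreal d * emeasure (hausdorff_measure (?n - 1)) (frontier E) = ennreal ?n * X"
    using d(2)[of G] by (simp add: X_def mult.left_commute)
  then have "enn2real (ennreal d * emeasure (hausdorff_measure (?n - 1)) (frontier E)) = enn2real (ennreal ?n * X)"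
    by simp
  then have area: "d * measure (hausdorff_measure (?n - 1)) (frontier E) = ?n * enn2real X"
    using d(1) by (simp add: enn2real_mult measure_def)

  have "W = ennreal d * (\<integral>\<^sup>+ x. indicator (cball 0 1) (Q x) \<partial>lborel)"
    unfolding W_def using d(2)[of "indicator (cball 0 1)"] by simp
  also have "(\<integral>\<^sup>+ x. indicator (cball 0 1) (Q x) \<partial>lborel) = (\<integral>\<^sup>+ x. indicator E x \<partial>lborel)"
    by (intro nn_integral_cong) (simp add: E E.enorm_def indicator_def)
  also have "\<dots> = emeasure lborel E" unfolding E by (intro nn_integral_indicator) measurable
  finally have "enn2real W = d * measure lborel E"
    using d(1) by (simp add: enn2real_mult measure_def)
  then have vol: "d * measure lborel E = enn2real W" ..

  \<comment> \<open>The same integral \<open>X\<close> over the unit ball, now as an integral over the sphere.\<close>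
  have "(\<integral>\<^sup>+ u. ennreal (norm (Q u)) \<partial>sphere_area) =
      ennreal ?n * (\<integral>\<^sup>+ x. ennreal (norm (Q (x /\<^sub>R norm x))) * indicator (cball 0 1) x \<partial>lborel)"
    by (rule nn_integral_sphere_area[OF assms(1)]) measurable
  also have "(\<integral>\<^sup>+ x. ennreal (norm (Q (x /\<^sub>R norm x))) * indicator (cball 0 1) x \<partial>lborel) = X"
    unfolding X_def G_def by (simp add: linear_scale[OF linQ] divide_inverse_commute)
  finally have "(\<integral>\<^sup>+ u. ennreal (norm (Q u)) \<partial>sphere_area) = ennreal ?n * X" .
  then have int: "(\<integral>u. norm (Q u) \<partial>sphere_area) = ?n * enn2real X"
    by (subst integral_eq_nn_integral)
       (auto simp: enn2real_mult sphere_area_def intro!: measurable_restrict_space1)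

  have "emeasure (sphere_area :: (real ^ 'n) measure) (sphere 0 1) = (\<integral>\<^sup>+ u. 1 \<partial>(sphere_area :: (real ^ 'n) measure))"
    by (simp add: sphere_area_def space_restrict_space)
  also have "\<dots> = ennreal ?n * W"
    by (subst nn_integral_sphere_area[OF assms(1)]) (simp_all add: W_def)
  finally have tot: "measure (sphere_area :: (real ^ 'n) measure) (sphere 0 1) = ?n * enn2real W"
    by (simp add: measure_def enn2real_mult)

  have "measure (hausdorff_measure (?n - 1)) (frontier E) / measure lborel E = ?n * enn2real X / enn2real W"
    using area vol d(1) by (metis less_irrefl mult_divide_mult_cancel_left)
  also have "\<dots> = ?n * sphere_average (\<lambda>u. norm (Q u))"
    using W by (simp add: sphere_average_def int tot)
  finally show ?thesis by (simp add: normQ)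
qed

end
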